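(* Let $R\in SO_n$ satisfy all of the following conditions: its nonreal complex eigenvalues all have multiplicity $1$; either $-1$ is not an eigenvalue of $R$ or it has multiplicity $2$; either $1$ is not an eigenvalue of $R$ or it has multiplicity at most $2$. Let $q=\lfloor n/2\rfloor$ and fix $B=\sum_{h=1}^{q}\theta_hB_h\in\mathcal{A}plog(R)$ constructed as in the context. If $-1$ is not an eigenvalue of $R$ (i.e. $\theta_1\ne\pi$), then $\mathcal{A}plog(R)=\{B\}$, while if $-1$ is an eigenvalue of $R$ (i.e. $\theta_1=\pi$), then $\mathcal{A}plog(R)$ consists of $B=\pi B_1+\sum_{h=2}^q\theta_hB_h$ and $-\pi B_1+\sum_{h=2}^q\theta_hB_h$. Moreover, a real skew symmetric matrix $A$ of order $n$ is a real skew symmetric logarithm of $R$ if and only if $$A=\sum_{h=1}^q(\theta_h+2\pi r_h)B_h=B+2\pi\sum_{h=1}^q r_hB_h$$ for some $r_1,\dots,r_q\in\mathbb{Z}$. In particular the set of all real skew symmetric logarithms of $R$ is a discrete lattice of rank $\lfloor n/2\rfloor$ in the vector space $\mathcal{A}_n$ of real skew symmetric matrices of order $n$.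
   Context: $SO_n$, $O_n$ are the real special orthogonal and orthogonal groups of order $n$. A real skew symmetric logarithm of $R$ is a real skew symmetric matrix $X$ with $\exp(X)=R$; it is principal if all its (complex) eigenvalues have absolute value in $[0,\pi]$; $\mathcal{A}plog(R)$ is the set of principal ones. Construction of $B$. Under the hypotheses on $R$, its eigenvalues are $e^{\pm \mathbf{i}\theta_1},\dots,e^{\pm \mathbf{i}\theta_p}$ with $\theta_1,\dots,\theta_p\in(0,\pi]$ distinct (with the convention that $\theta_1=\pi$ if $-1$ is an eigenvalue), each pair occurring once, together with $1$ with multiplicity $n-2p\le2$. Let $E_0=\begin{pmatrix}0&1\\-1&0\end{pmatrix}$, so $\exp(\theta E_0)=\begin{pmatrix}\cos\theta&\sin\theta\\-\sin\theta&\cos\theta\end{pmatrix}$. Choose $K\in O_n$ with $$R=K\operatorname{diag}(\exp(\theta_1E_0),\dots,\exp(\theta_pE_0),\underbrace{1,\dots,1}_{n-2p})K^T .$$ If $n=2p+2$ (i.e. $1$ is an eigenvalue of multiplicity $2$), put $\theta_{p+1}=0$. With $q=\lfloor n/2\rfloor$ set $B_h=K\operatorname{diag}(\underbrace{0,\dots,0}_{2h-2},E_0,\underbrace{0,\dots,0}_{n-2h})K^T$ for $1\le h\le q$, and $B=\sum_{h=1}^q\theta_hB_h$, which is a real skew symmetric principal logarithm of $R$. *)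

theory Defs
  imports "HOL-Analysis.Analysis" "HOL-Computational_Algebra.Polynomial"
begin

(* The product of the type class "times" on real^'n^'n is componentwise, so that neither
   "power" nor "exp" from the library refers to the matrix product. *)

primrec matpow :: "real^'n^'n \<Rightarrow> nat \<Rightarrow> real^'n^'n" where
  "matpow A 0 = mat 1"
| "matpow A (Suc k) = A ** matpow A k"

definition matexp :: "real^'n^'n \<Rightarrow> real^'n^'n" where
  "matexp A = (\<Sum>k. matpow A k /\<^sub>R fact k)"

definition complexify :: "real^'n^'n \<Rightarrow> complex^'n^'n" where
  "complexify A = map_matrix complex_of_real A"

definition charpoly :: "complex^'n^'n \<Rightarrow> complex poly" where
  "charpoly M = det (mat [:0, 1:] - map_matrix (\<lambda>c. [:c:]) M)"

definition is_eigenvalue :: "complex^'n^'n \<Rightarrow> complex \<Rightarrow> bool" where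
  "is_eigenvalue M c \<longleftrightarrow> (\<exists>v. v \<noteq> 0 \<and> M *v v = c *s v)"

definition eig_mult :: "complex^'n^'n \<Rightarrow> complex \<Rightarrow> nat" where
  "eig_mult M c = order c (charpoly M)"

definition skew_matrices :: "(real^'n^'n) set" where
  "skew_matrices = {A. transpose A = - A}"

definition skew_logs :: "real^'n^'n \<Rightarrow> (real^'n^'n) set" where
  "skew_logs R = {X \<in> skew_matrices. matexp X = R}"

definition Aplog :: "real^'n^'n \<Rightarrow> (real^'n^'n) set" where
  "Aplog R = {X \<in> skew_logs R. \<forall>c. is_eigenvalue (complexify X) c \<longrightarrow> cmod c \<in> {0..pi}}"

definition E0 :: "real^2^2" where
  "E0 = vector [vector [0, 1], vector [-1, 0]]"

(* diag(M 1, ..., M p, c, ..., c), a matrix of order CARD('n) made of p blocks of order 2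
   followed by CARD('n) - 2 p scalar blocks.  The index type 'n carries no order, so "num"
   numbers the rows and columns by 1, ..., CARD('n); the h-th block of order 2 occupies the
   rows and columns with numbers 2 h - 1 and 2 h. *)
definition block_diag ::
    "('n \<Rightarrow> nat) \<Rightarrow> nat \<Rightarrow> (nat \<Rightarrow> real^2^2) \<Rightarrow> real \<Rightarrow> real^'n^'n" where
  "block_diag num p M c = (\<chi> i j.
     if num i \<le> 2 * p \<and> num j \<le> 2 * p then
       (if (num i + 1) div 2 = (num j + 1) div 2
        then M ((num i + 1) div 2) $ (if odd (num i) then 1 else 2)
                                   $ (if odd (num j) then 1 else 2)
        else 0)
     else if i = j then c else 0)"

(* The data (p, theta_1, ..., theta_q, K) from which B is built; theta is only relevant on
   {1..q}, where q = p, except that q = p + 1 if CARD('n) = 2 p + 2. *)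
definition log_data ::
    "real^'n^'n \<Rightarrow> ('n \<Rightarrow> nat) \<Rightarrow> nat \<Rightarrow> (nat \<Rightarrow> real) \<Rightarrow> real^'n^'n \<Rightarrow> bool" where
  "log_data R num p \<theta> K \<longleftrightarrow>
     bij_betw num UNIV {1..CARD('n)} \<and>
     2 * p \<le> CARD('n) \<and> CARD('n) - 2 * p \<le> 2 \<and>
     (\<forall>h\<in>{1..p}. \<theta> h \<in> {0<..pi}) \<and>
     inj_on \<theta> {1..p} \<and>
     (is_eigenvalue (complexify R) (-1) \<longrightarrow> 1 \<le> p \<and> \<theta> 1 = pi) \<and>
     (CARD('n) = 2 * p + 2 \<longrightarrow> \<theta> (p + 1) = 0) \<and>
     orthogonal_matrix K \<and>
     R = K ** block_diag num p (\<lambda>h. matexp (\<theta> h *\<^sub>R E0)) 1 ** transpose K"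

definition Bmat :: "('n \<Rightarrow> nat) \<Rightarrow> real^'n^'n \<Rightarrow> nat \<Rightarrow> real^'n^'n" where
  "Bmat num K h =
     K ** block_diag num (CARD('n) div 2) (\<lambda>k. if k = h then E0 else 0) 0 ** transpose K"

(* "Lattice" is meant in the affine sense, as a translate of the integer span of k linearly
   independent vectors: a set of logarithms contains 0 only if R is the identity. *)
definition discrete_lattice_in :: "'a::euclidean_space set \<Rightarrow> nat \<Rightarrow> 'a set \<Rightarrow> bool" where
  "discrete_lattice_in V k L \<longleftrightarrow>
     L \<subseteq> V \<and> discrete L \<and>
     (\<exists>a\<in>V. \<exists>G\<subseteq>V. finite G \<and> card G = k \<and> independent G \<and>
        L = {a + (\<Sum>g\<in>G. real_of_int (m g) *\<^sub>R g) | m :: 'a \<Rightarrow> int. True})"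

end

theory Submission
  imports Defs
begin

text \<open>A skew logarithm \<open>A\<close> of \<open>R\<close> commutes with \<open>R = exp A\<close> and hence with \<open>R + R\<^sup>T\<close>. In the basis
  given by \<open>K\<close> the latter is diagonal with the entry \<open>2 cos \<theta>\<^sub>h\<close> on block \<open>h\<close>, and these numbers are
  distinct, so that \<open>A\<close> is block diagonal too. A skew block of order \<open>2\<close> is a multiple \<open>x\<^sub>h E\<^sub>0\<close>, and
  comparing exponentials gives \<open>x\<^sub>h = \<theta>\<^sub>h + 2 \<pi> r\<^sub>h\<close>. The eigenvalues of \<open>A\<close> are \<open>\<plusminus>\<i> x\<^sub>h\<close> and possibly
  \<open>0\<close>, which singles out the principal logarithms. The data \<open>K, \<theta>\<close> exist because every nonzero
  subspace invariant under \<open>R\<close> and \<open>R\<^sup>T\<close> contains an eigenvector for \<open>\<plusminus>1\<close> or a plane on which \<open>R\<close> is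
  a rotation; the angles are distinct by the assumption on multiplicities.\<close>

section \<open>The matrix exponential\<close>

text \<open>Passing from \<open>R\<close> to R + R^T turns commutation into a comparison of entries:
  each plane of the normal form lies in an eigenspace of a diagonal matrix, and cos is injective on
  [0, pi], so different planes have different eigenvalues. The delicate eigenvalue is 1. When it has
  multiplicity 2, its eigenspace is counted as one more plane, of angle 0. This is why there are q =
  floor(n/2) planes rather than p, and why at most one index, present exactly for odd n, lies
  outside the planes. A skew matrix that splits along the planes vanishes there, so a logarithm
  amounts to q real coordinates. Distinct angles are essential: with equal angles a logarithm could
  mix two planes, and continuous families of logarithms would appear. The eigenvalue -1 is treated
  as a rotation by pi, the only angle for which both \<theta> and \<theta> - 2 pi lie in [-pi, pi].
  Multiplicities are orders of roots of a characteristic polynomial; an explicit complex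
  diagonalization connects them with the number of planes and lines.\<close>

lemma bounded_bilinear_matrix_mult:
  "bounded_bilinear ((**) :: real^'n^'n \<Rightarrow> real^'n^'n \<Rightarrow> real^'n^'n)"
proof -
  have "bilinear ((**) :: real^'n^'n \<Rightarrow> real^'n^'n \<Rightarrow> real^'n^'n)"
    unfolding bilinear_def linear_iff
    by (simp add: matrix_add_ldistrib matrix_scalar_ac scalar_matrix_assoc)
      (simp add: matrix_matrix_mult_def vec_eq_iff sum.distrib distrib_right)
  then show ?thesis
    by (simp add: bilinear_conv_bounded_bilinear)
qed

lemmas bounded_linear_matrix_mult_left =
  bounded_bilinear.bounded_linear_left[OF bounded_bilinear_matrix_mult]
lemmas bounded_linear_matrix_mult_right =
  bounded_bilinear.bounded_linear_right[OF bounded_bilinear_matrix_mult]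

lemma matpow_commute: "matpow A k ** A = A ** matpow A k"
  by (induction k) (simp_all flip: matrix_mul_assoc)

text \<open>The bound C of the bilinear product stands in for submultiplicativity of the norm: the
  series is dominated by that of exp (norm A * C), up to the factor norm (mat 1).\<close>

lemma summable_matexp:
  fixes A :: "real^'n^'n"
  shows "summable (\<lambda>k. matpow A k /\<^sub>R fact k)"
proof -
  have "\<exists>C>0. \<forall>(X :: real^'n^'n) (Y :: real^'n^'n). norm (X ** Y) \<le> norm X * norm Y * C"
    by (rule bounded_bilinear.pos_bounded[OF bounded_bilinear_matrix_mult])
  then obtain C where C: "C > 0" "\<And>(X :: real^'n^'n) (Y :: real^'n^'n). norm (X ** Y) \<le> norm X * norm Y * C"
    by auto
  have bound: "norm (matpow A k) \<le> norm (mat 1 :: real^'n^'n) * (norm A * C) ^ k" for k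
  proof (induction k)
    case (Suc k)
    have "norm (matpow A (Suc k)) \<le> norm A * norm (matpow A k) * C"
      using C(2) by simp
    also have "\<dots> \<le> norm A * (norm (mat 1 :: real^'n^'n) * (norm A * C) ^ k) * C"
      using Suc C(1) by (intro mult_left_mono mult_right_mono) auto
    finally show ?case by (simp add: mult_ac)
  qed simp
  have "summable (\<lambda>k. norm (mat 1 :: real^'n^'n) * ((norm A * C) ^ k /\<^sub>R fact k))"
    by (intro summable_mult summable_exp_generic)
  then show ?thesis
  proof (rule summable_comparison_test')
    fix k show "norm (matpow A k /\<^sub>R fact k) \<le> norm (mat 1 :: real^'n^'n) * ((norm A * C) ^ k /\<^sub>R fact k)"
      using bound[of k] by (simp add: field_simps)
  qed
qed

lemma matexp_sums: "(\<lambda>k. matpow A k /\<^sub>R fact k) sums matexp A"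
  unfolding matexp_def by (rule summable_sums[OF summable_matexp])

lemma matexp_eqI: "(\<lambda>k. matpow A k /\<^sub>R fact k) sums X \<Longrightarrow> matexp A = X"
  using matexp_sums sums_unique2 by blast

text \<open>Both products are limits of the same sums, since A commutes with its powers. This is how
  a logarithm of R comes to commute with R.\<close>

lemma matexp_commute: "A ** matexp A = matexp A ** A"
proof -
  have "(\<lambda>k. A ** (matpow A k /\<^sub>R fact k)) sums (A ** matexp A)"
    by (rule bounded_linear.sums[OF bounded_linear_matrix_mult_right matexp_sums])
  moreover have "(\<lambda>k. (matpow A k /\<^sub>R fact k) ** A) sums (matexp A ** A)"
    by (rule bounded_linear.sums[OF bounded_linear_matrix_mult_left matexp_sums])
  moreover have "A ** (matpow A k /\<^sub>R fact k) = (matpow A k /\<^sub>R fact k) ** A" for k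
    by (simp add: linear_scale[OF bounded_linear.linear[OF bounded_linear_matrix_mult_right]]
        linear_scale[OF bounded_linear.linear[OF bounded_linear_matrix_mult_left]] matpow_commute)
  ultimately show ?thesis
    using sums_unique2 by simp
qed

section \<open>Conjugation by orthogonal matrices\<close>

lemma orthogonal_matrix_cancel:
  assumes "orthogonal_matrix (K :: real^'n^'n)"
  shows "transpose K ** (K ** X) = X" "K ** (transpose K ** X) = X"
  using assms by (simp_all add: orthogonal_matrix_def matrix_mul_assoc)

lemma orthogonal_conj_mult:
  assumes "orthogonal_matrix (K :: real^'n^'n)"
  shows "(K ** X ** transpose K) ** (K ** Y ** transpose K) = K ** (X ** Y) ** transpose K"
  using assms by (simp add: orthogonal_matrix_cancel flip: matrix_mul_assoc)

lemma orthogonal_conj_cancel: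
  assumes "orthogonal_matrix (K :: real^'n^'n)"
  shows "transpose K ** (K ** X ** transpose K) ** K = X"
    and "K ** (transpose K ** X ** K) ** transpose K = X"
  using assms by (simp_all add: orthogonal_matrix_cancel flip: matrix_mul_assoc)
    (simp_all add: orthogonal_matrix_def)

lemma orthogonal_conj_eq_iff:
  assumes "orthogonal_matrix (K :: real^'n^'n)"
  shows "K ** X ** transpose K = K ** Y ** transpose K \<longleftrightarrow> X = Y"
  by (metis orthogonal_conj_cancel(1)[OF assms])

lemma matpow_conj:
  assumes "orthogonal_matrix (K :: real^'n^'n)"
  shows "matpow (K ** X ** transpose K) k = K ** matpow X k ** transpose K"
proof (induction k)
  case 0
  then show ?case using assms by (simp add: orthogonal_matrix_def)
next
  case (Suc k)
  then show ?case using assms by (simp add: orthogonal_conj_mult)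
qed

lemma bounded_linear_conj: "bounded_linear (\<lambda>X :: real^'n^'n. K ** X ** (L :: real^'n^'n) :: real^'n^'n)"
  using bounded_linear_compose[OF bounded_linear_matrix_mult_left[of L] bounded_linear_matrix_mult_right[of K]] .

lemma matexp_conj:
  assumes "orthogonal_matrix (K :: real^'n^'n)"
  shows "matexp (K ** X ** transpose K) = K ** matexp X ** transpose K"
proof (rule matexp_eqI)
  have "(\<lambda>k. K ** (matpow X k /\<^sub>R fact k) ** transpose K) sums (K ** matexp X ** transpose K)"
    by (rule bounded_linear.sums[OF bounded_linear_conj matexp_sums])
  then show "(\<lambda>k. matpow (K ** X ** transpose K) k /\<^sub>R fact k) sums (K ** matexp X ** transpose K)"
    by (simp add: matpow_conj[OF assms] linear_scale[OF bounded_linear.linear[OF bounded_linear_conj]])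
qed

text \<open>Since \<open>E\<^sub>0\<close> squares to \<open>- 1\<close>, it plays the role of \<open>\<i>\<close>, and exponentials of its
  multiples are read off from the complex exponential.\<close>

definition cplx :: "complex \<Rightarrow> real^2^2" where
  "cplx z = vector [vector [Re z, Im z], vector [- Im z, Re z]]"

lemma cplx_nth [simp]:
  "cplx z $ 1 $ 1 = Re z" "cplx z $ 1 $ 2 = Im z" "cplx z $ 2 $ 1 = - Im z" "cplx z $ 2 $ 2 = Re z"
  by (simp_all add: cplx_def)

lemma mat2_eq_iff:
  "(A :: 'a^2^2) = B \<longleftrightarrow> A$1$1 = B$1$1 \<and> A$1$2 = B$1$2 \<and> A$2$1 = B$2$1 \<and> A$2$2 = B$2$2"
  by (auto simp: vec_eq_iff forall_2)

lemma cplx_eq_iff: "cplx z = cplx w \<longleftrightarrow> z = w"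
  by (auto simp: mat2_eq_iff complex_eq_iff)

lemma cplx_mult: "cplx z ** cplx w = cplx (z * w)"
  by (simp add: mat2_eq_iff matrix_matrix_mult_def sum_2 algebra_simps)

lemma cplx_1: "cplx 1 = mat 1"
  by (simp add: mat2_eq_iff mat_def)

lemma cplx_E0: "x *\<^sub>R E0 = cplx (\<i> * of_real x)"
  by (simp add: mat2_eq_iff E0_def)

lemma transpose_cplx: "transpose (cplx z) = cplx (cnj z)"
  by (simp add: mat2_eq_iff transpose_def)

lemma bounded_linear_cplx: "bounded_linear cplx"
  by (intro linear_conv_bounded_linear[THEN iffD1])
    (simp add: linear_iff mat2_eq_iff)

lemma matpow_cplx: "matpow (cplx z) k = cplx (z ^ k)"
  by (induction k) (simp_all add: cplx_1 cplx_mult)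

lemma matexp_cplx: "matexp (cplx z) = cplx (exp z)"
proof (rule matexp_eqI)
  have "(\<lambda>k. cplx (z ^ k /\<^sub>R fact k)) sums cplx (exp z)"
    by (rule bounded_linear.sums[OF bounded_linear_cplx exp_converges])
  then show "(\<lambda>k. matpow (cplx z) k /\<^sub>R fact k) sums cplx (exp z)"
    by (simp add: matpow_cplx linear_scale[OF bounded_linear.linear[OF bounded_linear_cplx]])
qed

lemma matexp_E0: "matexp (x *\<^sub>R E0) = cplx (cis x)"
  by (simp add: cplx_E0 matexp_cplx cis_conv_exp)

section \<open>Block diagonal matrices\<close>

text \<open>Other entry types and a varying tail are needed: complex blocks for the diagonalization,
  a tail of entries -1 and 1 for the normal form, a tail of zeros for skew matrices.\<close>

definition blk ::
    "('n \<Rightarrow> nat) \<Rightarrow> nat \<Rightarrow> (nat \<Rightarrow> 'a^2^2) \<Rightarrow> ('n \<Rightarrow> 'a) \<Rightarrow> 'a::zero^'n^'n" where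
  "blk num p M d = (\<chi> i j.
     if num i \<le> 2 * p \<and> num j \<le> 2 * p then
       (if (num i + 1) div 2 = (num j + 1) div 2
        then M ((num i + 1) div 2) $ (if odd (num i) then 1 else 2)
                                   $ (if odd (num j) then 1 else 2)
        else 0)
     else if i = j then d i else 0)"

lemma block_diag_eq_blk: "block_diag num p M c = blk num p M (\<lambda>_. c)"
  by (simp add: block_diag_def blk_def)

text \<open>The index of row \<open>s\<close> of block \<open>h\<close>, that is, the one numbered \<open>2 h - 1\<close> or \<open>2 h\<close>.\<close>

definition pos :: "('n \<Rightarrow> nat) \<Rightarrow> nat \<Rightarrow> 2 \<Rightarrow> 'n" where
  "pos num h s = inv num (if s = 1 then 2 * h - 1 else 2 * h)"

lemma two_neq_one [simp]: "(2 :: 2) \<noteq> 1" "(1 :: 2) \<noteq> 2"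
  by simp_all

locale numbering =
  fixes num :: "'n::finite \<Rightarrow> nat" and p :: nat
  assumes bij_num: "bij_betw num UNIV {1..CARD('n)}"
    and le_card: "2 * p \<le> CARD('n)"
begin

lemma inj_num: "num i = num j \<longleftrightarrow> i = j"
  using bij_num by (auto simp: bij_betw_def inj_on_def)

lemma num_inv: "m \<in> {1..CARD('n)} \<Longrightarrow> num (inv num m) = m"
  using bij_num by (metis bij_betw_imp_surj_on f_inv_into_f)

lemma num_ge1: "1 \<le> num i"
  using bij_num by (auto simp: bij_betw_def)

lemma num_pos:
  assumes "h \<in> {1..p}"
  shows "num (pos num h s) = (if s = 1 then 2 * h - 1 else 2 * h)"
  unfolding pos_def using assms le_card by (subst num_inv) auto

lemma pos_cases:
  obtains h s where "h \<in> {1..p}" "i = pos num h s" | "num i > 2 * p"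
proof (cases "num i > 2 * p")
  case False
  define h where "h = (num i + 1) div 2"
  have h: "h \<in> {1..p}" using False num_ge1[of i] by (auto simp: h_def)
  have "num i = 2 * h - 1 \<or> num i = 2 * h" using num_ge1[of i] unfolding h_def by presburger
  then have "num i = num (pos num h 1) \<or> num i = num (pos num h 2)"
    using h by (simp add: num_pos)
  then show ?thesis using h that(1) by (auto simp: inj_num)
qed

lemma num_pos_facts:
  assumes "h \<in> {1..p}"
  shows "num (pos num h s) \<le> 2 * p" "(num (pos num h s) + 1) div 2 = h"
    "odd (num (pos num h s)) \<longleftrightarrow> s = 1"
  using assms by (auto simp: num_pos)

lemma pos_eq_iff:
  assumes "h \<in> {1..p}" "k \<in> {1..p}"
  shows "pos num h s = pos num k t \<longleftrightarrow> h = k \<and> s = t"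
  using num_pos_facts[OF assms(1), of s] num_pos_facts[OF assms(2), of t] exhaust_2[of s] exhaust_2[of t]
  by metis

lemma blk_nth:
  assumes "h \<in> {1..p}" "k \<in> {1..p}"
  shows "blk num p M d $ pos num h s $ pos num k t = (if h = k then M h $ s $ t else 0)"
  using num_pos_facts[OF assms(1), of s] num_pos_facts[OF assms(2), of t] exhaust_2[of s] exhaust_2[of t]
  by (auto simp: blk_def)

lemma blk_nth_tail:
  "num i > 2 * p \<Longrightarrow> blk num p M d $ i $ j = (if i = j then d i else 0)"
  "num j > 2 * p \<Longrightarrow> blk num p M d $ i $ j = (if i = j then d i else 0)"
  by (simp_all add: blk_def)

lemma blk_nth_other:
  assumes "h \<in> {1..p}" "i \<notin> {pos num h 1, pos num h 2}"
  shows "blk num p M d $ pos num h s $ i = 0" "blk num p M d $ i $ pos num h s = 0"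
proof -
  have "blk num p M d $ pos num h s $ i = 0 \<and> blk num p M d $ i $ pos num h s = 0"
  proof (cases i rule: pos_cases)
    case (1 k t)
    then have "h \<noteq> k" using assms exhaust_2[of t] by auto
    then show ?thesis using 1 assms by (simp add: blk_nth)
  next
    case 2
    then show ?thesis using num_pos_facts(1)[OF assms(1), of s] by (auto simp: blk_nth_tail)
  qed
  then show "blk num p M d $ pos num h s $ i = 0" "blk num p M d $ i $ pos num h s = 0" by auto
qed

text \<open>A row through a block has at most two nonzero entries, so a sum over all indices
  collapses to the two terms of a product of order 2.\<close>

lemma sum_blk_row:
  fixes f :: "'n \<Rightarrow> 'a::semiring_1"
  assumes "h \<in> {1..p}"
  shows "(\<Sum>k\<in>UNIV. blk num p M d $ pos num h s $ k * f k) =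
    M h $ s $ 1 * f (pos num h 1) + M h $ s $ 2 * f (pos num h 2)"
proof -
  have "(\<Sum>k\<in>UNIV. blk num p M d $ pos num h s $ k * f k) =
      (\<Sum>k\<in>{pos num h 1, pos num h 2}. blk num p M d $ pos num h s $ k * f k)"
    by (rule sum.mono_neutral_right) (auto simp: blk_nth_other[OF assms])
  then show ?thesis using assms by (simp add: pos_eq_iff blk_nth)
qed

lemma sum_blk_col:
  fixes f :: "'n \<Rightarrow> 'a::semiring_1"
  assumes "h \<in> {1..p}"
  shows "(\<Sum>k\<in>UNIV. f k * blk num p M d $ k $ pos num h s) =
    f (pos num h 1) * M h $ 1 $ s + f (pos num h 2) * M h $ 2 $ s"
proof -
  have "(\<Sum>k\<in>UNIV. f k * blk num p M d $ k $ pos num h s) =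
      (\<Sum>k\<in>{pos num h 1, pos num h 2}. f k * blk num p M d $ k $ pos num h s)"
    by (rule sum.mono_neutral_right) (auto simp: blk_nth_other[OF assms])
  then show ?thesis using assms by (simp add: pos_eq_iff blk_nth)
qed

lemma sum_blk_row_tail:
  fixes f :: "'n \<Rightarrow> 'a::semiring_1"
  assumes "num i > 2 * p"
  shows "(\<Sum>k\<in>UNIV. blk num p M d $ i $ k * f k) = d i * f i"
  using assms by (simp add: blk_nth_tail if_distrib[of "\<lambda>x. x * _"] cong: if_cong)

lemma sum_blk_col_tail:
  fixes f :: "'n \<Rightarrow> 'a::semiring_1"
  assumes "num j > 2 * p"
  shows "(\<Sum>k\<in>UNIV. f k * blk num p M d $ k $ j) = f j * d j"
  using assms by (simp add: blk_nth_tail if_distrib[of "\<lambda>x. _ * x"] cong: if_cong)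

lemma blk_eqI:
  assumes "\<And>h k s t. h \<in> {1..p} \<Longrightarrow> k \<in> {1..p} \<Longrightarrow>
      X $ pos num h s $ pos num k t = (if h = k then M h $ s $ t else 0)"
    and "\<And>i j. num i > 2 * p \<Longrightarrow> X $ i $ j = (if i = j then d i else 0)"
    and "\<And>i j. num j > 2 * p \<Longrightarrow> X $ i $ j = (if i = j then d i else 0)"
  shows "X = blk num p M d"
proof -
  have "X $ i $ j = blk num p M d $ i $ j" for i j
    by (cases i rule: pos_cases; cases j rule: pos_cases)
      (simp_all add: assms blk_nth blk_nth_tail)
  then show ?thesis by (simp add: vec_eq_iff)
qed

lemma blk_eq_iff:
  "blk num p M d = blk num p N e \<longleftrightarrow>
    (\<forall>h\<in>{1..p}. M h = N h) \<and> (\<forall>i. num i > 2 * p \<longrightarrow> d i = e i)"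
proof
  assume eq: "blk num p M d = blk num p N e"
  have "M h $ s $ t = N h $ s $ t" if "h \<in> {1..p}" for h s t
    using blk_nth[OF that that, of M d s t] blk_nth[OF that that, of N e s t] eq by simp
  moreover have "d i = e i" if "num i > 2 * p" for i
    using blk_nth_tail(1)[OF that, of M d i] blk_nth_tail(1)[OF that, of N e i] eq by simp
  ultimately show "(\<forall>h\<in>{1..p}. M h = N h) \<and> (\<forall>i. num i > 2 * p \<longrightarrow> d i = e i)"
    by (simp add: vec_eq_iff)
next
  assume "(\<forall>h\<in>{1..p}. M h = N h) \<and> (\<forall>i. num i > 2 * p \<longrightarrow> d i = e i)"
  then show "blk num p M d = blk num p N e"
    by (intro blk_eqI) (auto simp: blk_nth blk_nth_tail)
qed

lemma blk_mult:
  fixes M N :: "nat \<Rightarrow> 'a::semiring_1^2^2"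
  shows "blk num p M d ** blk num p N e = blk num p (\<lambda>h. M h ** N h) (\<lambda>i. d i * e i)"
proof (rule blk_eqI)
  fix h k s t assume hk: "h \<in> {1..p}" "k \<in> {1..p}"
  then show "(blk num p M d ** blk num p N e) $ pos num h s $ pos num k t =
      (if h = k then (M h ** N h) $ s $ t else 0)"
    by (simp add: matrix_matrix_mult_def sum_blk_row[OF hk(1)] blk_nth[OF hk(1) hk(2)] sum_2)
next
  fix i j assume "num i > 2 * p"
  then show "(blk num p M d ** blk num p N e) $ i $ j = (if i = j then d i * e i else 0)"
    by (simp add: matrix_matrix_mult_def sum_blk_row_tail) (auto simp: blk_nth_tail)
next
  fix i j assume "num j > 2 * p"
  then show "(blk num p M d ** blk num p N e) $ i $ j = (if i = j then d i * e i else 0)"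
    by (simp add: matrix_matrix_mult_def sum_blk_col_tail) (auto simp: blk_nth_tail)
qed

lemma transpose_blk: "transpose (blk num p M d) = blk num p (\<lambda>h. transpose (M h)) d"
  by (rule blk_eqI) (auto simp: transpose_def blk_nth blk_nth_tail)

lemma blk_add: "blk num p M d + blk num p N e = blk num p (\<lambda>h. M h + N h) (\<lambda>i. d i + e i :: 'a::monoid_add)"
  by (rule blk_eqI) (auto simp: blk_nth blk_nth_tail)

lemma blk_scaleR: "c *\<^sub>R blk num p M d = blk num p (\<lambda>h. c *\<^sub>R M h) (\<lambda>i. c *\<^sub>R d i)"
  by (rule blk_eqI) (auto simp: blk_nth blk_nth_tail)

lemma blk_1: "blk num p (\<lambda>_. mat 1) (\<lambda>_. 1) = mat 1"
  by (rule blk_eqI[symmetric]) (auto simp: mat_def pos_eq_iff)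

lemma map_matrix_blk:
  "f 0 = 0 \<Longrightarrow> map_matrix f (blk num p M d) = blk num p (\<lambda>h. map_matrix f (M h)) (\<lambda>i. f (d i))"
  by (rule blk_eqI) (auto simp: blk_nth blk_nth_tail)

lemma matpow_blk: "matpow (blk num p M d) k = blk num p (\<lambda>h. matpow (M h) k) (\<lambda>i. d i ^ k)"
  by (induction k) (simp_all add: blk_1 blk_mult)

lemma sums_vecI:
  assumes "\<And>i. (\<lambda>k. f k $ i) sums (a $ i)"
  shows "f sums (a :: 'a::real_normed_vector^'m)"
  using assms unfolding sums_def by (intro vec_tendstoI) simp

lemma sums_blk:
  assumes "\<And>h. h \<in> {1..p} \<Longrightarrow> (\<lambda>k. M k h) sums N h"
    and "\<And>i. num i > 2 * p \<Longrightarrow> (\<lambda>k. d k i) sums e i"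
  shows "(\<lambda>k. blk num p (M k) (d k)) sums blk num p N (e :: _ \<Rightarrow> real)"
proof (intro sums_vecI)
  fix i j
  show "(\<lambda>k. blk num p (M k) (d k) $ i $ j) sums (blk num p N e $ i $ j)"
  proof (cases i rule: pos_cases)
    case i: (1 h s)
    show ?thesis
    proof (cases j rule: pos_cases)
      case j: (1 h' t)
      have "(\<lambda>k. M k h $ s $ t) sums (N h $ s $ t)"
        by (intro bounded_linear.sums[OF bounded_linear_vec_nth] assms i)
      then show ?thesis using i j by (auto simp: blk_nth)
    next
      case 2
      then show ?thesis using assms(2) by (auto simp: blk_nth_tail)
    qed
  next
    case 2
    then show ?thesis using assms(2) by (auto simp: blk_nth_tail)
  qed
qed

lemma matexp_blk: "matexp (blk num p M d) = blk num p (\<lambda>h. matexp (M h)) (\<lambda>i. exp (d i))"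
proof (rule matexp_eqI)
  have "(\<lambda>k. blk num p (\<lambda>h. matpow (M h) k /\<^sub>R fact k) (\<lambda>i. d i ^ k /\<^sub>R fact k)) sums
      blk num p (\<lambda>h. matexp (M h)) (\<lambda>i. exp (d i))"
    by (intro sums_blk matexp_sums exp_converges)
  then show "(\<lambda>k. matpow (blk num p M d) k /\<^sub>R fact k) sums
      blk num p (\<lambda>h. matexp (M h)) (\<lambda>i. exp (d i))"
    by (simp add: matpow_blk blk_scaleR)
qed

end

section \<open>Eigenvalues and multiplicities\<close>

definition diag_matrix :: "('n \<Rightarrow> 'a) \<Rightarrow> 'a::zero^'n^'n" where
  "diag_matrix lam = (\<chi> i j. if i = j then lam i else 0)"

lemma diag_matrix_mult_vec:
  fixes lam :: "'n::finite \<Rightarrow> 'a::semiring_1"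
  shows "(diag_matrix lam *v y) $ i = lam i * y $ i"
  by (simp add: diag_matrix_def matrix_vector_mult_def if_distrib[of "\<lambda>x. x * _"] cong: if_cong)

lemma mat_mult_commute:
  fixes Y :: "'a::comm_semiring_1^'n^'n"
  shows "mat c ** Y = Y ** mat c"
proof -
  have "(mat c ** Y) $ i $ j = c * Y $ i $ j" for i j
    by (simp add: mat_def matrix_matrix_mult_def if_distrib[of "\<lambda>x. x * _"] cong: if_cong)
  moreover have "(Y ** mat c) $ i $ j = c * Y $ i $ j" for i j
    by (simp add: mat_def matrix_matrix_mult_def if_distrib[of "\<lambda>x. _ * x"] mult.commute cong: if_cong)
  ultimately show ?thesis by (simp add: vec_eq_iff)
qed

text \<open>The order at c is additive over the factors, and a linear factor contributes 1 exactly
  when its root is c.\<close>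

lemma order_prod_linear:
  fixes lam :: "'n \<Rightarrow> complex"
  assumes "finite I"
  shows "order c (\<Prod>i\<in>I. [:- lam i, 1:]) = card {i \<in> I. lam i = c}"
  using assms
proof (induction I rule: finite_induct)
  case empty
  then show ?case by (simp add: order_0I)
next
  case (insert j I)
  have ne: "[:- lam j, 1:] * (\<Prod>i\<in>I. [:- lam i, 1:]) \<noteq> 0"
    using insert by (simp del: mult_pCons_left)
  have "order c [:- lam j, 1:] = (if lam j = c then 1 else 0)"
    using order_power_n_n[of c 1] by (auto intro!: order_0I)
  moreover have "{i \<in> insert j I. lam i = c} =
      (if lam j = c then insert j {i \<in> I. lam i = c} else {i \<in> I. lam i = c})"
    by auto
  ultimately show ?case
    using insert by (simp add: order_mult[OF ne] del: mult_pCons_left)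
qed

lemma map_matrix_poly_mult:
  "map_matrix (\<lambda>c. [:c:]) (A ** B) = map_matrix (\<lambda>c. [:c:]) A ** map_matrix (\<lambda>c. [:c:]) (B :: complex^'n^'n)"
proof -
  have "[:\<Sum>k\<in>S. f k:] = (\<Sum>k\<in>S. [:f k:])" for f :: "'n \<Rightarrow> complex" and S
    by (simp add: poly_eq_iff coeff_sum coeff_pCons split: nat.splits)
  then show ?thesis
    by (simp add: vec_eq_iff matrix_matrix_mult_def mult.commute)
qed

text \<open>Stated with products only, so that a concrete P can be checked block by block; a
  one-sided inverse suffices because the matrices are square.\<close>

locale diagonalization =
  fixes M P P' :: "complex^'n^'n" and lam :: "'n \<Rightarrow> complex"
  assumes intertwine: "M ** P = P ** diag_matrix lam"
    and inverse: "P ** P' = mat 1"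
begin

lemma inverse': "P' ** P = mat 1"
  using inverse matrix_left_right_inverse by blast

lemma is_eigenvalue_iff: "is_eigenvalue M c \<longleftrightarrow> (\<exists>i. lam i = c)"
proof
  assume "is_eigenvalue M c"
  then obtain v where v: "v \<noteq> 0" "M *v v = c *s v"
    by (auto simp: is_eigenvalue_def)
  define y where "y = P' *v v"
  have vy: "v = P *v y"
    by (simp add: y_def matrix_vector_mul_assoc inverse)
  have "y \<noteq> 0" using v(1) vy by auto
  then obtain i where i: "y $ i \<noteq> 0" by (auto simp: vec_eq_iff)
  have "P *v (diag_matrix lam *v y) = M *v v"
    by (simp add: vy matrix_vector_mul_assoc intertwine)
  also have "\<dots> = P *v (c *s y)"
    using v(2) by (simp add: vy vector_scalar_commute)
  finally have "P' *v (P *v (diag_matrix lam *v y)) = P' *v (P *v (c *s y))"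
    by simp
  then have "diag_matrix lam *v y = c *s y"
    by (simp add: matrix_vector_mul_assoc matrix_mul_assoc inverse')
  then have "lam i * y $ i = c * y $ i"
    using diag_matrix_mult_vec[of lam y i] by auto
  then show "\<exists>i. lam i = c" using i by auto
next
  assume "\<exists>i. lam i = c"
  then obtain i where i: "lam i = c" by auto
  define y :: "complex^'n" where "y = axis i 1"
  have "diag_matrix lam *v y = c *s y"
    by (auto simp: vec_eq_iff diag_matrix_mult_vec y_def axis_def i)
  moreover have "M *v (P *v y) = P *v (diag_matrix lam *v y)"
    by (simp add: matrix_vector_mul_assoc intertwine)
  ultimately have "M *v (P *v y) = c *s (P *v y)"
    by (simp add: vector_scalar_commute)
  moreover have "P *v y \<noteq> 0"
  proof
    assume "P *v y = 0"
    then have "P' *v (P *v y) = 0" by simp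
    then have "y = 0" by (simp add: matrix_vector_mul_assoc inverse')
    then show False by (simp add: y_def)
  qed
  ultimately show "is_eigenvalue M c" by (auto simp: is_eigenvalue_def)
qed

text \<open>Similar matrices have the same characteristic polynomial. Over the polynomial ring this
  holds because the scalar matrix of the indeterminate commutes with P and determinants are
  multiplicative.\<close>

lemma eig_mult_eq: "eig_mult M c = card {i. lam i = c}"
proof -
  let ?C = "map_matrix (\<lambda>c. [:c:]) :: complex^'n^'n \<Rightarrow> complex poly^'n^'n"
  let ?X = "mat [:0, 1:] :: complex poly^'n^'n"
  have "?C (mat 1) = mat 1" by (simp add: vec_eq_iff mat_def one_poly_eq_simps)
  then have "?C P ** ?C P' = mat 1"
    by (metis inverse map_matrix_poly_mult)
  then have "det (?C P) * det (?C P') = 1"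
    by (metis det_I det_mul)
  \<comment> \<open>Only this is needed of P over the polynomials: they form an integral domain, so
    a nonzero determinant can be cancelled.\<close>
  then have nz: "det (?C P) \<noteq> 0" by auto
  have comm: "?X ** Y = Y ** ?X" for Y
    by (rule mat_mult_commute)
  have minus: "(A - B) ** Y = A ** Y - B ** Y" "Y ** (A - B) = Y ** A - Y ** B"
    for A B Y :: "complex poly^'n^'n"
    by (simp_all add: vec_eq_iff matrix_matrix_mult_def left_diff_distrib right_diff_distrib sum_subtractf)
  have "(?X - ?C M) ** ?C P = ?C P ** (?X - ?C (diag_matrix lam))"
    by (simp add: minus comm intertwine flip: map_matrix_poly_mult)
  then have "charpoly M * det (?C P) = det (?C P) * det (?X - ?C (diag_matrix lam))"
    unfolding charpoly_def by (metis det_mul)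
  then have "charpoly M = det (?X - ?C (diag_matrix lam))"
    using nz by simp
  also have "\<dots> = (\<Prod>i\<in>UNIV. [:- lam i, 1:])"
    by (subst det_diagonal) (auto simp: mat_def diag_matrix_def)
  finally show ?thesis
    by (simp add: eig_mult_def order_prod_linear)
qed

end

context numbering
begin

text \<open>The spectrum listed along the indices, a conjugate pair for each block, so that the
  multiplicity of a value is the size of its fibre.\<close>

definition eigs :: "(nat \<Rightarrow> complex) \<Rightarrow> ('n \<Rightarrow> real) \<Rightarrow> 'n \<Rightarrow> complex" where
  "eigs z d i = (if num i \<le> 2 * p then
     (if odd (num i) then z ((num i + 1) div 2) else cnj (z ((num i + 1) div 2)))
     else of_real (d i))"

lemma eigs_pos:
  "h \<in> {1..p} \<Longrightarrow> eigs z d (pos num h s) = (if s = 1 then z h else cnj (z h))"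
  by (simp only: eigs_def num_pos_facts if_True)

lemma eigs_tail: "num i > 2 * p \<Longrightarrow> eigs z d i = of_real (d i)"
  by (simp add: eigs_def)

lemma diag_matrix_eigs:
  "diag_matrix (eigs z d) =
    blk num p (\<lambda>h. vector [vector [z h, 0], vector [0, cnj (z h)]]) (\<lambda>i. of_real (d i))"
proof (rule blk_eqI)
  fix h k s t assume "h \<in> {1..p}" "k \<in> {1..p}"
  then show "diag_matrix (eigs z d) $ pos num h s $ pos num k t =
      (if h = k then vector [vector [z h, 0], vector [0, cnj (z h)]] $ s $ t else 0)"
    using exhaust_2[of s] exhaust_2[of t] by (auto simp: diag_matrix_def eigs_pos pos_eq_iff)
qed (auto simp: diag_matrix_def eigs_tail)

text \<open>The columns \<open>(1, \<plusminus>\<i>)\<close> are eigenvectors of every block \<^term>\<open>cplx z\<close>.\<close>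

lemma diagonalization_blk:
  assumes "orthogonal_matrix K"
  shows "\<exists>P P'. diagonalization
    (complexify (K ** blk num p (\<lambda>h. cplx (z h)) d ** transpose K)) P P' (eigs z d)"
proof -
  let ?r = "map_matrix complex_of_real :: real^'n^'n \<Rightarrow> complex^'n^'n"
  define Q :: "complex^2^2" where "Q = vector [vector [1, 1], vector [\<i>, - \<i>]]"
  define Q' :: "complex^2^2" where "Q' = vector [vector [1/2, - \<i>/2], vector [1/2, \<i>/2]]"
  define W where "W = blk num p (\<lambda>_. Q) (\<lambda>_. 1)"
  define W' where "W' = blk num p (\<lambda>_. Q') (\<lambda>_. 1)"
  have mult: "?r (A ** B) = ?r A ** ?r B" for A B
    by (simp add: vec_eq_iff matrix_matrix_mult_def)
  have "Q ** Q' = mat 1"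
    by (simp add: Q_def Q'_def mat2_eq_iff matrix_matrix_mult_def sum_2 mat_def)
  then have WW': "W ** W' = mat 1"
    by (simp add: W_def W'_def blk_mult blk_1)
  have "?r (mat 1) = mat 1" by (simp add: vec_eq_iff mat_def)
  then have KK: "?r K ** ?r (transpose K) = mat 1" "?r (transpose K) ** ?r K = mat 1"
    using assms by (metis mult orthogonal_matrix_def)+
  have "map_matrix complex_of_real (cplx w) ** Q = Q ** vector [vector [w, 0], vector [0, cnj w]]" for w
    by (simp add: Q_def mat2_eq_iff matrix_matrix_mult_def sum_2 complex_eq_iff)
  then have DW: "?r (blk num p (\<lambda>h. cplx (z h)) d) ** W = W ** diag_matrix (eigs z d)"
    by (simp add: W_def map_matrix_blk blk_mult diag_matrix_eigs)
  have "complexify (K ** blk num p (\<lambda>h. cplx (z h)) d ** transpose K) ** (?r K ** W)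
      = ?r K ** (?r (blk num p (\<lambda>h. cplx (z h)) d) ** ((?r (transpose K) ** ?r K) ** W))"
    by (simp only: complexify_def mult matrix_mul_assoc)
  also have "\<dots> = ?r K ** W ** diag_matrix (eigs z d)"
    by (simp add: KK DW flip: matrix_mul_assoc)
  moreover have "(?r K ** W) ** (W' ** ?r (transpose K)) = ?r K ** ((W ** W') ** ?r (transpose K))"
    by (simp only: matrix_mul_assoc)
  then have "(?r K ** W) ** (W' ** ?r (transpose K)) = mat 1"
    by (simp add: WW' KK)
  ultimately show ?thesis
    unfolding diagonalization_def by metis
qed

lemma is_eigenvalue_blk:
  assumes "orthogonal_matrix K"
  shows "is_eigenvalue (complexify (K ** blk num p (\<lambda>h. cplx (z h)) d ** transpose K)) c \<longleftrightarrow>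
    (\<exists>h\<in>{1..p}. c = z h \<or> c = cnj (z h)) \<or> (\<exists>i. num i > 2 * p \<and> c = of_real (d i))"
proof -
  have "(\<exists>i. eigs z d i = c) \<longleftrightarrow>
      (\<exists>h\<in>{1..p}. c = z h \<or> c = cnj (z h)) \<or> (\<exists>i. num i > 2 * p \<and> c = of_real (d i))"
    (is "?L \<longleftrightarrow> ?R")
  proof
    assume ?L
    then obtain i where "eigs z d i = c" by auto
    then show ?R
      by (cases i rule: pos_cases) (auto simp: eigs_pos eigs_tail split: if_splits)
  next
    assume ?R
    then show ?L
      by (metis eigs_pos eigs_tail two_neq_one(1))
  qed
  moreover obtain P P' where "diagonalization
      (complexify (K ** blk num p (\<lambda>h. cplx (z h)) d ** transpose K)) P P' (eigs z d)"
    using diagonalization_blk[OF assms] by blast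
  ultimately show ?thesis
    by (simp add: diagonalization.is_eigenvalue_iff)
qed

lemma eig_mult_blk:
  assumes "orthogonal_matrix K"
  shows "eig_mult (complexify (K ** blk num p (\<lambda>h. cplx (z h)) d ** transpose K)) c =
    card {i. eigs z d i = c}"
proof -
  obtain P P' where "diagonalization
      (complexify (K ** blk num p (\<lambda>h. cplx (z h)) d ** transpose K)) P P' (eigs z d)"
    using diagonalization_blk[OF assms] by blast
  then show ?thesis
    by (rule diagonalization.eig_mult_eq)
qed

end

section \<open>The normal form of an orthogonal matrix\<close>

lemma orthogonal_matrix_transpose_cancel:
  assumes "orthogonal_matrix (R :: real^'n^'n)"
  shows "R *v (x v* R) = x" "(R *v x) v* R = x"
proof -
  have "R *v (transpose R *v x) = x" "transpose R *v (R *v x) = x"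
    using assms by (simp_all only: matrix_vector_mul_assoc orthogonal_matrix_def matrix_vector_mul_lid)
  then show "R *v (x v* R) = x" "(R *v x) v* R = x" by simp_all
qed

lemma inner_matrix_vector: "x \<bullet> (R *v y) = (x v* R) \<bullet> (y :: real^'n)"
  by (simp add: dot_lmul_matrix)

lemma orthogonal_matrix_inner:
  assumes "orthogonal_matrix (R :: real^'n^'n)"
  shows "(R *v x) \<bullet> (R *v y) = x \<bullet> y"
  by (simp add: inner_matrix_vector orthogonal_matrix_transpose_cancel[OF assms])

text \<open>A maximum point of \<open>x \<bullet> R x\<close> on the unit sphere of \<open>V\<close> is an eigenvector of the
  symmetric part of \<open>R\<close>.\<close>

lemma symmetric_part_eigenvector:
  fixes R :: "real^'n^'n"
  assumes V: "subspace V" "\<exists>x\<in>V. x \<noteq> 0"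
    and inv: "\<And>x. x \<in> V \<Longrightarrow> R *v x \<in> V" "\<And>x. x \<in> V \<Longrightarrow> x v* R \<in> V"
  obtains u c where "u \<in> V" "norm u = 1" "R *v u + u v* R = (2 * c) *\<^sub>R u" "c = u \<bullet> (R *v u)"
proof -
  define f where "f x = x \<bullet> (R *v x)" for x :: "real^'n"
  define S where "S = V \<inter> sphere 0 1"
  obtain x0 where "x0 \<in> V" "x0 \<noteq> 0" using V(2) by blast
  then have "x0 /\<^sub>R norm x0 \<in> S" using V(1) by (simp add: S_def subspace_scale)
  then have "S \<noteq> {}" by blast
  moreover have "compact S"
    unfolding S_def by (intro closed_Int_compact closed_subspace V compact_sphere)
  moreover have "continuous_on S f"
    unfolding f_def by (intro continuous_intros linear_continuous_on) simp
  ultimately obtain u where u: "u \<in> S" "\<forall>y\<in>S. f y \<le> f u"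
    using continuous_attains_sup by blast
  then have uV: "u \<in> V" and nu: "norm u = 1" by (auto simp: S_def)
  have uu: "u \<bullet> u = 1" using nu by (simp add: norm_eq_1)
  define c where "c = f u"
  have quad: "f x \<le> c * (x \<bullet> x)" if "x \<in> V" for x
  proof (cases "x = 0")
    case False
    then have "x /\<^sub>R norm x \<in> S" using that V(1) by (simp add: S_def subspace_scale)
    then have "f (x /\<^sub>R norm x) \<le> c" using u(2) c_def by blast
    then have "f x / (x \<bullet> x) \<le> c"
      by (simp add: f_def matrix_vector_mult_scaleR power2_norm_eq_inner[symmetric] power2_eq_square field_simps)
    then show ?thesis using False by (simp add: field_simps)
  qed (simp add: f_def)
  \<comment> \<open>The defect of the eigenvector equation. It lies in V, so that u may be varied in
    its direction.\<close>
  define w where "w = (2 * c) *\<^sub>R u - R *v u - u v* R"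
  have wV: "w \<in> V"
    unfolding w_def by (intro subspace_diff subspace_scale V inv uV)
  have cross: "2 * c * (u \<bullet> w) - u \<bullet> (R *v w) - w \<bullet> (R *v u) = w \<bullet> w"
  proof -
    have "w \<bullet> w = ((2 * c) *\<^sub>R u - R *v u - u v* R) \<bullet> w"
      by (simp add: w_def)
    also have "\<dots> = 2 * c * (u \<bullet> w) - (R *v u) \<bullet> w - (u v* R) \<bullet> w"
      by (simp only: inner_diff_left inner_scaleR_left)
    finally show ?thesis by (simp add: inner_matrix_vector[of u R w] inner_commute[of w "R *v u"])
  qed
  have w0: "w \<bullet> w = 0"
  proof -
    define a where "a = w \<bullet> w"
    define b where "b = c * a - f w"
    have b: "b \<ge> 0" using quad[OF wV] by (simp add: a_def b_def)
    \<comment> \<open>This is \<open>quad\<close> at u + t w: the constant terms cancel, and by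
      \<open>cross\<close> the linear coefficient is w \<bullet> w.\<close>
    have pos: "0 \<le> t * a + t^2 * b" for t
    proof -
      have "u + t *\<^sub>R w \<in> V" by (intro subspace_add subspace_scale V uV wV)
      from quad[OF this] have e1: "f (u + t *\<^sub>R w) \<le> c * ((u + t *\<^sub>R w) \<bullet> (u + t *\<^sub>R w))" .
      have e2: "f (u + t *\<^sub>R w) = c + t * (u \<bullet> (R *v w) + w \<bullet> (R *v u)) + t^2 * f w"
        by (simp add: f_def c_def matrix_vector_right_distrib matrix_vector_mult_scaleR inner_add_left
            inner_add_right power2_eq_square algebra_simps)
      have e3: "(u + t *\<^sub>R w) \<bullet> (u + t *\<^sub>R w) = 1 + 2 * t * (u \<bullet> w) + t^2 * a"
        by (simp add: a_def uu inner_add_left inner_add_right inner_commute[of w u] power2_eq_square algebra_simps)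
      have "0 \<le> t * (2 * c * (u \<bullet> w) - u \<bullet> (R *v w) - w \<bullet> (R *v u)) + t^2 * (c * a - f w)"
        using e1[unfolded e2 e3] by (simp add: algebra_simps)
      then show ?thesis by (simp add: cross a_def b_def)
    qed
    \<comment> \<open>At t = - e the quadratic has the value - e^2, which forces e = 0; the summand
      1 keeps the denominator positive when b = 0.\<close>
    define e where "e = a / (b + 1)"
    have a: "a = e * (b + 1)" using b by (simp add: e_def)
    have "0 \<le> (- e) * a + (- e)\<^sup>2 * b" by (rule pos)
    also have "\<dots> = - (e\<^sup>2)"
      by (simp add: a power2_eq_square algebra_simps)
    finally show ?thesis using a by (simp add: a_def)
  qed
  then have "w = 0" by simp
  then have "R *v u + u v* R = (2 * c) *\<^sub>R u" by (simp add: w_def algebra_simps)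
  then show ?thesis using that uV nu by (simp add: c_def f_def)
qed

text \<open>If 2 c is the eigenvalue of R + R^T at u, then c is the cosine of the angle between u
  and R u. For c = 1 or c = -1 this forces R u = c u; otherwise R (R u) = 2 c R u - u shows that u
  and R u span an invariant plane.\<close>

lemma invariant_line_or_plane:
  fixes R :: "real^'n^'n"
  assumes R: "orthogonal_matrix R" and V: "subspace V" "\<exists>x\<in>V. x \<noteq> 0"
    and inv: "\<And>x. x \<in> V \<Longrightarrow> R *v x \<in> V" "\<And>x. x \<in> V \<Longrightarrow> x v* R \<in> V"
  obtains (pos) u where "u \<in> V" "norm u = 1" "R *v u = u"
  | (neg) u where "u \<in> V" "norm u = 1" "R *v u = - u"
  | (plane) u v \<theta> where "u \<in> V" "v \<in> V" "norm u = 1" "norm v = 1" "u \<bullet> v = 0" "0 < \<theta>" "\<theta> < pi"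
      "R *v u = cos \<theta> *\<^sub>R u - sin \<theta> *\<^sub>R v" "R *v v = sin \<theta> *\<^sub>R u + cos \<theta> *\<^sub>R v"
proof -
  obtain u c where u: "u \<in> V" "norm u = 1" "R *v u + u v* R = (2 * c) *\<^sub>R u" "c = u \<bullet> (R *v u)"
    using symmetric_part_eigenvector[OF V inv] by metis
  have uu: "u \<bullet> u = 1" using u(2) by (simp add: norm_eq_1)
  have RuRu: "(R *v u) \<bullet> (R *v u) = 1" using uu orthogonal_matrix_inner[OF R] by simp
  have "\<bar>c\<bar> \<le> norm u * norm (R *v u)" using u(4) Cauchy_Schwarz_ineq2 by blast
  moreover have "norm (R *v u) = 1" by (simp only: norm_eq_1 RuRu)
  ultimately have c1: "-1 \<le> c" "c \<le> 1" using u(2) by auto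
  consider "c = 1" | "c = -1" | "-1 < c" "c < 1" using c1 by linarith
  then show ?thesis
  proof cases
    case 1
    have "(R *v u - u) \<bullet> (R *v u - u) = 0"
      using RuRu uu u(4) 1 by (simp add: inner_diff_left inner_diff_right inner_commute)
    then show ?thesis using pos u by simp
  next
    case 2
    have "(R *v u + u) \<bullet> (R *v u + u) = 0"
      using RuRu uu u(4) 2 by (simp add: inner_add_left inner_add_right inner_commute)
    then have "R *v u = - u" by (simp add: eq_neg_iff_add_eq_0)
    then show ?thesis using neg u by simp
  next
    case 3
    define \<theta> where "\<theta> = arccos c"
    have \<theta>: "0 < \<theta>" "\<theta> < pi" "cos \<theta> = c"
      using 3 arccos_lt_bounded[of c] by (auto simp: \<theta>_def)
    then have s: "sin \<theta> > 0" by (simp add: sin_gt_zero)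
    have s2: "sin \<theta> * sin \<theta> = 1 - c * c" using sin_squared_eq[of \<theta>] \<theta>(3) by (simp add: power2_eq_square)
    \<comment> \<open>The sign makes the matrix of R in the basis (u, v) equal to exp (\<theta> E0)
      rather than its inverse; the division by sin \<theta> normalizes v.\<close>
    define v where "v = (c *\<^sub>R u - R *v u) /\<^sub>R sin \<theta>"
    have sv: "sin \<theta> *\<^sub>R v = c *\<^sub>R u - R *v u" using s by (simp add: v_def)
    have Ru: "R *v u = cos \<theta> *\<^sub>R u - sin \<theta> *\<^sub>R v" by (simp add: sv \<theta>)
    \<comment> \<open>Applying R to the eigenvector equation replaces R^T u by u.\<close>
    have "R *v (R *v u + u v* R) = R *v ((2 * c) *\<^sub>R u)" using u(3) by simp
    then have RRu: "R *v (R *v u) = (2 * c) *\<^sub>R (R *v u) - u"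
      by (simp add: matrix_vector_right_distrib matrix_vector_mult_scaleR orthogonal_matrix_transpose_cancel[OF R] eq_diff_eq)
    have "sin \<theta> *\<^sub>R (R *v v) = R *v (c *\<^sub>R u - R *v u)"
      by (simp flip: sv matrix_vector_mult_scaleR)
    also have "\<dots> = u - c *\<^sub>R (R *v u)"
      by (simp add: matrix_vector_mult_diff_distrib matrix_vector_mult_scaleR RRu algebra_simps flip: scaleR_add_left)
    also have "\<dots> = (1 - c * c) *\<^sub>R u + (c * sin \<theta>) *\<^sub>R v"
      by (simp add: Ru \<theta>(3) algebra_simps)
    also have "\<dots> = sin \<theta> *\<^sub>R (sin \<theta> *\<^sub>R u + cos \<theta> *\<^sub>R v)"
      by (simp add: \<theta>(3) scaleR_add_right mult.commute flip: s2)
    finally have Rv: "R *v v = sin \<theta> *\<^sub>R u + cos \<theta> *\<^sub>R v" using s by simp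
    have vV: "v \<in> V" unfolding v_def by (intro subspace_scale subspace_diff V inv u)
    have "sin \<theta> * (u \<bullet> v) = u \<bullet> (c *\<^sub>R u - R *v u)" by (simp flip: sv)
    then have uv: "u \<bullet> v = 0" using s uu u(4) by (simp add: inner_diff_right)
    have "(sin \<theta> * sin \<theta>) * (v \<bullet> v) = (c *\<^sub>R u - R *v u) \<bullet> (c *\<^sub>R u - R *v u)" by (simp flip: sv)
    also have "\<dots> = sin \<theta> * sin \<theta>"
      using uu u(4) RuRu by (simp add: s2 inner_diff_left inner_diff_right inner_commute algebra_simps)
    finally have "v \<bullet> v = 1" using s by simp
    then have nv: "norm v = 1" by (simp add: norm_eq_1)
    show ?thesis using plane[OF u(1) vV u(2) nv uv \<theta>(1,2) Ru Rv] .
  qed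
qed

section \<open>Orthonormal systems of invariant planes and lines\<close>

fun plane_vecs :: "(real \<times> 'a \<times> 'a) list \<Rightarrow> 'a list" where
  "plane_vecs [] = []"
| "plane_vecs ((\<theta>, u, v) # xs) = u # v # plane_vecs xs"

lemma length_plane_vecs [simp]: "length (plane_vecs xs) = 2 * length xs"
  by (induction xs rule: plane_vecs.induct) auto

lemma plane_vecs_nth:
  "h < length xs \<Longrightarrow> plane_vecs xs ! (2 * h) = fst (snd (xs ! h)) \<and>
    plane_vecs xs ! Suc (2 * h) = snd (snd (xs ! h))"
proof (induction xs arbitrary: h rule: plane_vecs.induct)
  case (2 \<theta> u v xs)
  then show ?case by (cases h) auto
qed simp

lemma set_plane_vecs: "x \<in> set (plane_vecs xs) \<longleftrightarrow> (\<exists>\<theta> u v. (\<theta>, u, v) \<in> set xs \<and> (x = u \<or> x = v))"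
  by (induction xs rule: plane_vecs.induct) auto

text \<open>A list, since positions become column numbers. Distinctness is demanded separately
  because the underlying set does not show repetitions.\<close>

definition orthonormal_list :: "'a::real_inner list \<Rightarrow> bool" where
  "orthonormal_list l \<longleftrightarrow>
    distinct l \<and> (\<forall>x\<in>set l. norm x = 1) \<and> pairwise orthogonal (set l)"

lemma orthonormal_list_Cons:
  "orthonormal_list (x # l) \<longleftrightarrow> norm x = 1 \<and> (\<forall>y\<in>set l. orthogonal y x) \<and> orthonormal_list l"
proof -
  have "x \<notin> set l" if "norm x = 1" "\<forall>y\<in>set l. orthogonal y x"
    using that by (auto simp: orthogonal_def norm_eq_1)
  then show ?thesis
    by (auto simp: orthonormal_list_def pairwise_insert orthogonal_commute)
qed

lemma orthonormal_list_cong: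
  "mset l = mset l' \<Longrightarrow> orthonormal_list l \<longleftrightarrow> orthonormal_list l'"
  using mset_eq_setD mset_eq_imp_distinct_iff unfolding orthonormal_list_def by metis

lemma orthonormal_list_nth:
  assumes "orthonormal_list l" "i < length l" "j < length l"
  shows "l ! i \<bullet> l ! j = (if i = j then 1 else 0)"
  using assms by (auto simp: orthonormal_list_def norm_eq_1 pairwise_def orthogonal_def nth_eq_iff_index_eq)

lemma orthonormal_list_length_le:
  assumes "orthonormal_list (l :: 'a::euclidean_space list)"
  shows "length l \<le> DIM('a)"
proof -
  have "0 \<notin> set l" using assms by (auto simp: orthonormal_list_def)
  then have "independent (set l)"
    using assms by (simp add: orthonormal_list_def pairwise_orthogonal_independent)
  then show ?thesis
    using assms independent_bound distinct_card by (metis orthonormal_list_def)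
qed

text \<open>Planes and the eigenvectors for -1 and 1 are kept apart: in a complete system with
  angles strictly between 0 and pi, the multiplicities of -1 and 1 are the lengths of
  \<open>Ms\<close> and \<open>Ps\<close>.\<close>

definition normal_system ::
    "real^'n^'n \<Rightarrow> (real \<times> (real^'n) \<times> (real^'n)) list \<Rightarrow> (real^'n) list \<Rightarrow> (real^'n) list \<Rightarrow> bool" where
  "normal_system R Pl Ms Ps \<longleftrightarrow>
    orthonormal_list (plane_vecs Pl @ Ms @ Ps) \<and>
    (\<forall>(\<theta>, u, v)\<in>set Pl. R *v u = cos \<theta> *\<^sub>R u - sin \<theta> *\<^sub>R v \<and> R *v v = sin \<theta> *\<^sub>R u + cos \<theta> *\<^sub>R v) \<and>
    (\<forall>x\<in>set Ms. R *v x = - x) \<and> (\<forall>x\<in>set Ps. R *v x = x)"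

text \<open>The transpose acts on each plane by the inverse rotation and on the remaining vectors as
  R does. Invariance under both is what passes to the orthogonal complement.\<close>

lemma normal_system_span_invariant:
  fixes R :: "real^'n^'n"
  assumes R: "orthogonal_matrix R" and sys: "normal_system R Pl Ms Ps"
    and b: "b \<in> set (plane_vecs Pl @ Ms @ Ps)"
  shows "R *v b \<in> span (set (plane_vecs Pl @ Ms @ Ps))" "b v* R \<in> span (set (plane_vecs Pl @ Ms @ Ps))"
proof -
  let ?S = "set (plane_vecs Pl @ Ms @ Ps)"
  consider \<theta> u v where "(\<theta>, u, v) \<in> set Pl" "b = u \<or> b = v" | "b \<in> set Ms" | "b \<in> set Ps"
    using b by (auto simp: set_plane_vecs)
  then have "R *v b \<in> span ?S \<and> b v* R \<in> span ?S"
  proof cases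
    case (1 \<theta> u v)
    then have "u \<in> set (plane_vecs Pl)" "v \<in> set (plane_vecs Pl)"
      unfolding set_plane_vecs by blast+
    then have uv: "u \<in> span ?S" "v \<in> span ?S"
      by (simp_all add: span_base)
    have eq: "R *v u = cos \<theta> *\<^sub>R u - sin \<theta> *\<^sub>R v" "R *v v = sin \<theta> *\<^sub>R u + cos \<theta> *\<^sub>R v"
      using sys 1 by (auto simp: normal_system_def)
    have cs: "cos \<theta> * cos \<theta> + sin \<theta> * sin \<theta> = 1"
      by (rule sin_cos_squared_add3)
    \<comment> \<open>Since R^T inverts R, it is enough to exhibit a vector that R sends to u; the
      rotation by the opposite angle supplies it.\<close>
    have "R *v (cos \<theta> *\<^sub>R u + sin \<theta> *\<^sub>R v) = (cos \<theta> * cos \<theta> + sin \<theta> * sin \<theta>) *\<^sub>R u"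
      by (simp add: matrix_vector_right_distrib matrix_vector_mult_scaleR eq algebra_simps
          del: sin_cos_squared_add3)
    then have "R *v (cos \<theta> *\<^sub>R u + sin \<theta> *\<^sub>R v) = u" by (simp only: cs scaleR_one)
    then have u: "u v* R = cos \<theta> *\<^sub>R u + sin \<theta> *\<^sub>R v"
      using orthogonal_matrix_transpose_cancel(2)[OF R, of "cos \<theta> *\<^sub>R u + sin \<theta> *\<^sub>R v"] by simp
    have "R *v (cos \<theta> *\<^sub>R v - sin \<theta> *\<^sub>R u) = (cos \<theta> * cos \<theta> + sin \<theta> * sin \<theta>) *\<^sub>R v"
      by (simp add: matrix_vector_mult_diff_distrib matrix_vector_mult_scaleR eq algebra_simps
          del: sin_cos_squared_add3)
    then have "R *v (cos \<theta> *\<^sub>R v - sin \<theta> *\<^sub>R u) = v" by (simp only: cs scaleR_one)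
    then have v: "v v* R = cos \<theta> *\<^sub>R v - sin \<theta> *\<^sub>R u"
      using orthogonal_matrix_transpose_cancel(2)[OF R, of "cos \<theta> *\<^sub>R v - sin \<theta> *\<^sub>R u"] by simp
    have "R *v u \<in> span ?S" "R *v v \<in> span ?S" "u v* R \<in> span ?S" "v v* R \<in> span ?S"
      unfolding eq u v by (intro span_add span_diff span_scale uv)+
    then show ?thesis using 1 by auto
  next
    case 2
    then have e: "R *v b = - b" using sys by (auto simp: normal_system_def)
    then have "R *v (- b) = b" using matrix_vector_mult_diff_distrib[of R 0 b] by simp
    then have "b v* R = - b"
      using orthogonal_matrix_transpose_cancel(2)[OF R, of "- b"] by simp
    then show ?thesis using b e by (metis span_base span_neg)
  next
    case 3
    then have e: "R *v b = b" using sys by (auto simp: normal_system_def)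
    then have "b v* R = b"
      using orthogonal_matrix_transpose_cancel(2)[OF R, of b] by simp
    then show ?thesis using b e by (metis span_base)
  qed
  then show "R *v b \<in> span ?S" "b v* R \<in> span ?S" by auto
qed

text \<open>The orthogonal complement of an incomplete system is nonzero and invariant under R and
  R^T, so it contains a further line or plane, automatically orthogonal to the old vectors.\<close>

lemma normal_system_extend:
  fixes R :: "real^'n^'n"
  assumes R: "orthogonal_matrix R" and sys: "normal_system R Pl Ms Ps"
    and lt: "length (plane_vecs Pl @ Ms @ Ps) < CARD('n)"
    and Pl: "\<forall>(\<theta>, u, v)\<in>set Pl. 0 < \<theta> \<and> \<theta> < pi"
  shows "\<exists>Pl' Ms' Ps'. normal_system R Pl' Ms' Ps' \<and> (\<forall>(\<theta>, u, v)\<in>set Pl'. 0 < \<theta> \<and> \<theta> < pi) \<and>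
    length (plane_vecs Pl @ Ms @ Ps) < length (plane_vecs Pl' @ Ms' @ Ps')"
proof -
  define S where "S = set (plane_vecs Pl @ Ms @ Ps)"
  define V where "V = {x. \<forall>b\<in>S. orthogonal b x}"
  have sub: "subspace V"
    by (auto simp: V_def subspace_def orthogonal_clauses)
  have ex: "\<exists>x\<in>V. x \<noteq> 0"
  proof -
    have "dim S \<le> card S" by (simp add: S_def dim_le_card')
    also have "\<dots> < CARD('n)" unfolding S_def using card_length lt by (rule le_less_trans)
    finally obtain x where "x \<noteq> 0" "\<And>y. y \<in> span S \<Longrightarrow> orthogonal x y"
      using orthogonal_to_subspace_exists[of S] by auto
    then have "x \<in> V" by (auto simp: V_def orthogonal_def inner_commute span_base)
    then show ?thesis using \<open>x \<noteq> 0\<close> by blast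
  qed
  have span_orth: "orthogonal b x" if "x \<in> V" "b \<in> span S" for b x
    using that(2,1)
    by (induction b rule: span_induct) (auto simp: V_def subspace_def orthogonal_clauses)
  have inv1: "R *v x \<in> V" if "x \<in> V" for x
    unfolding V_def
  proof clarify
    fix b assume "b \<in> S"
    then have "orthogonal (b v* R) x"
      using normal_system_span_invariant(2)[OF R sys] span_orth that by (simp add: S_def)
    then show "orthogonal b (R *v x)" by (simp add: orthogonal_def inner_matrix_vector)
  qed
  have inv2: "x v* R \<in> V" if "x \<in> V" for x
    unfolding V_def
  proof clarify
    fix b assume "b \<in> S"
    then have "orthogonal (R *v b) x"
      using normal_system_span_invariant(1)[OF R sys] span_orth that by (simp add: S_def)
    then show "orthogonal b (x v* R)"
      by (simp add: orthogonal_def inner_commute inner_matrix_vector)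
  qed
  show ?thesis
  proof (rule invariant_line_or_plane[OF R sub ex inv1 inv2], goal_cases)
    case (3 u)
    have "orthonormal_list (plane_vecs Pl @ Ms @ (u # Ps)) \<longleftrightarrow> orthonormal_list (u # plane_vecs Pl @ Ms @ Ps)"
      by (rule orthonormal_list_cong) simp
    then have "normal_system R Pl Ms (u # Ps)"
      using sys 3 by (auto simp: normal_system_def orthonormal_list_Cons V_def S_def)
    then show ?thesis using Pl by (intro exI[of _ Pl] exI[of _ Ms] exI[of _ "u # Ps"]) simp
  next
    case (4 u)
    have "orthonormal_list (plane_vecs Pl @ (u # Ms) @ Ps) \<longleftrightarrow> orthonormal_list (u # plane_vecs Pl @ Ms @ Ps)"
      by (rule orthonormal_list_cong) simp
    then have "normal_system R Pl (u # Ms) Ps"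
      using sys 4 by (auto simp: normal_system_def orthonormal_list_Cons V_def S_def)
    then show ?thesis using Pl by (intro exI[of _ Pl] exI[of _ "u # Ms"] exI[of _ Ps]) simp
  next
    case (5 u v \<theta>)
    then have "normal_system R ((\<theta>, u, v) # Pl) Ms Ps"
      using sys by (auto simp: normal_system_def orthonormal_list_Cons V_def S_def orthogonal_def inner_commute)
    then show ?thesis using Pl 5
      by (intro exI[of _ "(\<theta>, u, v) # Pl"] exI[of _ Ms] exI[of _ Ps]) simp
  qed
qed

text \<open>The induction runs over a lower bound k for the length, since an extension adds one or
  two vectors. A plane cannot overshoot, as there are at most n orthonormal vectors.\<close>

lemma normal_system_exists:
  fixes R :: "real^'n^'n"
  assumes R: "orthogonal_matrix R"
  obtains Pl Ms Ps where "normal_system R Pl Ms Ps" "\<forall>(\<theta>, u, v)\<in>set Pl. 0 < \<theta> \<and> \<theta> < pi"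
    "length (plane_vecs Pl @ Ms @ Ps) = CARD('n)"
proof -
  have "k \<le> CARD('n) \<Longrightarrow> \<exists>Pl Ms Ps. normal_system R Pl Ms Ps \<and> (\<forall>(\<theta>, u, v)\<in>set Pl. 0 < \<theta> \<and> \<theta> < pi) \<and>
    k \<le> length (plane_vecs Pl @ Ms @ Ps)" for k
  proof (induction k)
    case 0
    have "normal_system R [] [] []" by (simp add: normal_system_def orthonormal_list_def)
    then show ?case by force
  next
    case (Suc k)
    then obtain Pl Ms Ps where IH: "normal_system R Pl Ms Ps" "\<forall>(\<theta>, u, v)\<in>set Pl. 0 < \<theta> \<and> \<theta> < pi"
      "k \<le> length (plane_vecs Pl @ Ms @ Ps)" by (meson Suc_leD)
    show ?case
    proof (cases "Suc k \<le> length (plane_vecs Pl @ Ms @ Ps)")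
      case True
      then show ?thesis using IH by blast
    next
      case False
      then have "length (plane_vecs Pl @ Ms @ Ps) < CARD('n)" using Suc.prems by linarith
      from normal_system_extend[OF R IH(1) this IH(2)] IH(3) show ?thesis
        by (meson Suc_leI le_less_trans)
    qed
  qed
  from this[of "CARD('n)"] obtain Pl Ms Ps where *: "normal_system R Pl Ms Ps"
    "\<forall>(\<theta>, u, v)\<in>set Pl. 0 < \<theta> \<and> \<theta> < pi" "CARD('n) \<le> length (plane_vecs Pl @ Ms @ Ps)" by blast
  moreover have "length (plane_vecs Pl @ Ms @ Ps) \<le> CARD('n)"
    using orthonormal_list_length_le[of "plane_vecs Pl @ Ms @ Ps"] *(1) by (simp add: normal_system_def)
  ultimately show ?thesis using that by force
qed

text \<open>The columns of K are the listed vectors, so R K = K D is a statement about each column.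
  Lists count from 0 and \<open>num\<close> counts from 1, hence the shifts.\<close>

lemma normal_system_matrix:
  fixes R :: "real^'n^'n" and num :: "'n \<Rightarrow> nat"
  assumes sys: "normal_system R Pl Ms Ps"
    and len: "length (plane_vecs Pl @ Ms @ Ps) = CARD('n)"
    and bij: "bij_betw num UNIV {1..CARD('n)}"
  shows "\<exists>K. orthogonal_matrix K \<and>
    R = K ** blk num (length Pl) (\<lambda>h. cplx (cis (fst (Pl ! (h - 1)))))
      (\<lambda>i. if num i \<le> 2 * length Pl + length Ms then - 1 else 1) ** transpose K"
proof -
  define p where "p = length Pl"
  define l where "l = plane_vecs Pl @ Ms @ Ps"
  interpret numbering num p
    using bij len by unfold_locales (simp_all add: p_def)
  define K :: "real^'n^'n" where "K = (\<chi> i j. (l ! (num j - 1)) $ i)"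
  define D :: "real^'n^'n" where "D = blk num p (\<lambda>h. cplx (cis (fst (Pl ! (h - 1)))))
      (\<lambda>i. if num i \<le> 2 * p + length Ms then - 1 else 1)"
  have num_lt: "num i - 1 < length l" for i
  proof -
    have "num i \<le> length l" using bij_betwE[OF bij] len by (simp add: l_def)
    then show ?thesis using num_ge1[of i] by linarith
  qed
  have on: "orthonormal_list l" using sys by (simp add: normal_system_def l_def)
  have "(transpose K ** K) $ i $ j = mat 1 $ i $ j" for i j
  proof -
    have "(transpose K ** K) $ i $ j = l ! (num i - 1) \<bullet> l ! (num j - 1)"
      by (simp add: matrix_matrix_mult_def transpose_def K_def inner_vec_def)
    also have "\<dots> = (if i = j then 1 else 0)"
    proof -
      have "num i - 1 = num j - 1 \<longleftrightarrow> i = j"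
        using num_ge1[of i] num_ge1[of j] inj_num[of i j] by auto
      then show ?thesis using orthonormal_list_nth[OF on num_lt num_lt, of i j] by simp
    qed
    finally show ?thesis by (simp add: mat_def)
  qed
  then have K: "orthogonal_matrix K" by (simp add: orthogonal_matrix vec_eq_iff)
  have RK: "(R ** K) $ i $ j = (R *v (l ! (num j - 1))) $ i" for i j
    by (simp add: matrix_matrix_mult_def matrix_vector_mult_def K_def)
  have "(R ** K) $ i $ j = (K ** D) $ i $ j" for i j
  proof (cases j rule: pos_cases)
    case (1 h s)
    obtain \<theta> u v where t: "Pl ! (h - 1) = (\<theta>, u, v)" by (cases "Pl ! (h - 1)")
    have h: "h - 1 < length Pl" using 1 by (auto simp: p_def)
    have mem: "(\<theta>, u, v) \<in> set Pl" using h t by (metis nth_mem)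
    have eq: "R *v u = cos \<theta> *\<^sub>R u - sin \<theta> *\<^sub>R v" "R *v v = sin \<theta> *\<^sub>R u + cos \<theta> *\<^sub>R v"
      using sys mem by (auto simp: normal_system_def)
    have idx: "2 * h - 1 - 1 = 2 * (h - 1)" "2 * h - 1 = Suc (2 * (h - 1))" using 1 by auto
    have "2 * h - 2 < length (plane_vecs Pl)" "2 * h - 1 < length (plane_vecs Pl)" using 1 h by auto
    then have lu: "l ! (num (pos num h 1) - 1) = u" "l ! (num (pos num h 2) - 1) = v"
      using plane_vecs_nth[OF h] num_pos[OF 1(1), of 1] num_pos[OF 1(1), of 2] t
      by (simp_all add: l_def nth_append idx del: One_nat_def)
    have KD: "(K ** D) $ i $ pos num h s = u $ i * cplx (cis \<theta>) $ 1 $ s + v $ i * cplx (cis \<theta>) $ 2 $ s"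
      unfolding D_def matrix_matrix_mult_def
      by (simp only: vec_lambda_beta sum_blk_col[OF 1(1)]) (simp only: K_def vec_lambda_beta lu t fst_conv)
    show ?thesis
      using exhaust_2[of s] unfolding 1(2) KD RK
      by (auto simp: lu[unfolded One_nat_def] eq algebra_simps)
  next
    case 2
    define m where "m = num j - 1 - 2 * p"
    have "\<not> num j - 1 < length (plane_vecs Pl)" using 2 by (simp add: p_def)
    then have lj: "l ! (num j - 1) = (Ms @ Ps) ! m" by (simp only: l_def nth_append if_False m_def p_def length_plane_vecs)
    have m: "m < length (Ms @ Ps)" using num_lt[of j] 2 by (auto simp: m_def l_def p_def)
    have "(K ** D) $ i $ j = (l ! (num j - 1)) $ i * (if num j \<le> 2 * p + length Ms then - 1 else 1)"
      unfolding D_def matrix_matrix_mult_def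
      by (simp only: vec_lambda_beta sum_blk_col_tail[OF 2]) (simp only: K_def vec_lambda_beta)
    moreover have "num j \<le> 2 * p + length Ms \<longleftrightarrow> m < length Ms" using 2 by (auto simp: m_def)
    moreover have "R *v ((Ms @ Ps) ! m) = (if m < length Ms then - 1 else 1) *\<^sub>R ((Ms @ Ps) ! m)"
      using sys m by (auto simp: normal_system_def nth_append)
    ultimately show ?thesis unfolding RK lj by simp
  qed
  then have "R ** K = K ** D" by (simp add: vec_eq_iff)
  then have "R = K ** D ** transpose K"
    using K by (metis matrix_mul_assoc matrix_mul_rid orthogonal_matrix_def)
  then show ?thesis using K unfolding D_def p_def by blast
qed

section \<open>Skew-symmetric logarithms\<close>

text \<open>All q planes are treated alike, with the angle 0 allowed. For odd n one index remains
  outside, with eigenvalue 1, and \<open>theta_odd\<close> keeps a plane of angle 0 from sharing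
  it.\<close>

locale rotation_form = numbering num q for num :: "'n::finite \<Rightarrow> nat" and q +
  fixes R K :: "real^'n^'n" and \<theta> :: "nat \<Rightarrow> real"
  assumes q: "q = CARD('n) div 2"
    and K: "orthogonal_matrix K"
    and R_eq: "R = K ** blk num q (\<lambda>h. cplx (cis (\<theta> h))) (\<lambda>_. 1) ** transpose K"
    and theta: "\<And>h. h \<in> {1..q} \<Longrightarrow> 0 \<le> \<theta> h \<and> \<theta> h \<le> pi"
    and inj_theta: "inj_on \<theta> {1..q}"
    and theta_odd: "\<And>h. odd CARD('n) \<Longrightarrow> h \<in> {1..q} \<Longrightarrow> \<theta> h \<noteq> 0"
begin

text \<open>The range of \<open>L\<close> is a Cartan subalgebra of the skew matrices, those
  preserving every plane; x gives linear coordinates in which exponentials are computed plane by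
  plane.\<close>

definition L :: "(nat \<Rightarrow> real) \<Rightarrow> real^'n^'n" where
  "L x = K ** blk num q (\<lambda>h. cplx (\<i> * of_real (x h))) (\<lambda>_. 0) ** transpose K"

definition coord :: "nat \<Rightarrow> real^'n^'n \<Rightarrow> real" where
  "coord h X = (transpose K ** X ** K) $ pos num h 1 $ pos num h 2"

lemma coord_L: "h \<in> {1..q} \<Longrightarrow> coord h (L x) = x h"
  unfolding coord_def L_def orthogonal_conj_cancel(1)[OF K] by (simp only: blk_nth) simp

lemma L_cong: "(\<And>h. h \<in> {1..q} \<Longrightarrow> x h = y h) \<Longrightarrow> L x = L y"
  unfolding L_def orthogonal_conj_eq_iff[OF K] blk_eq_iff by simp

lemma L_eq_iff: "L x = L y \<longleftrightarrow> (\<forall>h\<in>{1..q}. x h = y h)"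
  using L_cong coord_L by metis

lemma L_scale: "L (\<lambda>h. c * x h) = c *\<^sub>R L x"
proof -
  have "cplx (\<i> * of_real (c * x h)) = c *\<^sub>R cplx (\<i> * of_real (x h))" for h
    by (simp add: mat2_eq_iff)
  then show ?thesis
    unfolding L_def linear_scale[OF bounded_linear.linear[OF bounded_linear_conj], symmetric]
    by (simp add: blk_scaleR)
qed

lemma L_add: "L (\<lambda>h. x h + y h) = L x + L y"
proof -
  have "cplx (\<i> * of_real (x h + y h)) = cplx (\<i> * of_real (x h)) + cplx (\<i> * of_real (y h))" for h
    by (simp add: mat2_eq_iff)
  then show ?thesis
    unfolding L_def linear_add[OF bounded_linear.linear[OF bounded_linear_conj], symmetric]
    by (simp add: blk_add)
qed

lemma L_0: "L (\<lambda>_. 0) = 0"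
  using L_scale[of 0 "\<lambda>_. 0"] by simp

lemma L_diff: "L x - L y = L (\<lambda>h. x h - y h)"
  using L_add[of "\<lambda>h. x h - y h" y] by simp

lemma L_sum: "finite S \<Longrightarrow> L (\<lambda>k. \<Sum>h\<in>S. f h k) = (\<Sum>h\<in>S. L (f h))"
  by (induction S rule: finite_induct) (simp_all add: L_0 L_add)

lemma Bmat_eq_L: "Bmat num K h = L (\<lambda>k. if k = h then 1 else 0)"
proof -
  have "(if k = h then E0 else 0) = cplx (\<i> * of_real (if k = h then 1 else 0))" for k
    by (simp add: mat2_eq_iff E0_def)
  then show ?thesis
    unfolding Bmat_def L_def block_diag_eq_blk q[symmetric] by simp
qed

lemma L_eq_sum: "L x = (\<Sum>h=1..q. x h *\<^sub>R Bmat num K h)"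
proof -
  have "(\<Sum>h=1..q. x h *\<^sub>R Bmat num K h) = L (\<lambda>k. \<Sum>h=1..q. x h * (if k = h then 1 else 0))"
    by (simp add: L_sum Bmat_eq_L flip: L_scale)
  also have "\<dots> = L x"
    by (rule L_cong) (simp add: if_distrib[of "\<lambda>y. _ * y"] cong: if_cong)
  finally show ?thesis ..
qed

lemma transpose_L: "transpose (L x) = - L x"
proof -
  have "transpose (L x) = L (\<lambda>h. - 1 * x h)"
    by (simp add: L_def matrix_transpose_mul transpose_blk transpose_cplx matrix_mul_assoc)
  also have "\<dots> = - L x"
    by (subst L_scale) simp
  finally show ?thesis .
qed

lemma L_skew: "L x \<in> skew_matrices"
  by (simp add: skew_matrices_def transpose_L)

lemma matexp_L: "matexp (L x) = K ** blk num q (\<lambda>h. cplx (cis (x h))) (\<lambda>_. 1) ** transpose K"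
  by (simp add: L_def matexp_conj[OF K] matexp_blk matexp_cplx cis_conv_exp)

lemma matexp_L_eq_R: "matexp (L x) = R \<longleftrightarrow> (\<forall>h\<in>{1..q}. cis (x h) = cis (\<theta> h))"
  by (simp only: matexp_L R_eq orthogonal_conj_eq_iff[OF K] blk_eq_iff cplx_eq_iff simp_thms)

lemma cis_eq_iff: "cis x = cis y \<longleftrightarrow> (\<exists>n::int. x = y + 2 * pi * n)"
  using sin_cos_eq_iff[of x y] by (auto simp: cis.ctr complex_eq_iff)

lemma skew_log_eq_L:
  assumes "A \<in> skew_logs R"
  shows "\<exists>x. A = L x"
proof -
  define D where "D = blk num q (\<lambda>h. cplx (cis (\<theta> h))) (\<lambda>_. 1 :: real)"
  define A' where "A' = transpose K ** A ** K"
  define C where "C = blk num q (\<lambda>h. cplx (of_real (2 * cos (\<theta> h)))) (\<lambda>_. 2 :: real)"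
  have skew: "transpose A = - A" and AR: "A ** R = R ** A"
    using assms matexp_commute[of A] by (auto simp: skew_logs_def skew_matrices_def)
  have KT: "orthogonal_matrix (transpose K)" using K by (simp add: orthogonal_matrix_def)
  have D: "D = transpose K ** R ** K" by (simp add: R_eq orthogonal_conj_cancel(1)[OF K] D_def)
  have comm_D: "A' ** D = D ** A'"
    using orthogonal_conj_mult[OF KT, of A R] orthogonal_conj_mult[OF KT, of R A] AR
    by (simp add: A'_def D)
  have neg: "(- X) ** Y = - (X ** Y)" "X ** (- Y) = - (X ** Y)" for X Y :: "real^'n^'n"
    by (simp_all add: vec_eq_iff matrix_matrix_mult_def sum_negf)
  have skew': "transpose A' = - A'"
    by (simp add: A'_def matrix_transpose_mul skew neg matrix_mul_assoc)
  \<comment> \<open>Transposing reverses the products, and the signs from skewness cancel, so A'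
    commutes with D^T too.\<close>
  have "transpose (A' ** D) = transpose (D ** A')"
    using comm_D by simp
  then have "A' ** transpose D = transpose D ** A'"
    by (simp add: matrix_transpose_mul skew' neg)
  moreover have C: "C = D + transpose D"
  proof -
    have "cplx (cis (\<theta> h)) + cplx (cnj (cis (\<theta> h))) = cplx (of_real (2 * cos (\<theta> h)))" for h
      by (simp add: mat2_eq_iff)
    then show ?thesis by (simp add: D_def C_def transpose_blk transpose_cplx blk_add)
  qed
  ultimately have comm: "A' ** C = C ** A'"
    using comm_D unfolding C bounded_bilinear.add_left[OF bounded_bilinear_matrix_mult]
      bounded_bilinear.add_right[OF bounded_bilinear_matrix_mult] by simp
  \<comment> \<open>C is diagonal: on the right it scales columns, on the left rows. An entry of A'
    can be nonzero only where the two factors agree.\<close>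
  have col: "(A' ** C) $ i $ pos num k t = A' $ i $ pos num k t * (2 * cos (\<theta> k))" if "k \<in> {1..q}" for i k t
    unfolding matrix_matrix_mult_def C_def using exhaust_2[of t]
    by (simp only: vec_lambda_beta sum_blk_col[OF that]) auto
  have row: "(C ** A') $ pos num k t $ i = (2 * cos (\<theta> k)) * A' $ pos num k t $ i" if "k \<in> {1..q}" for i k t
    unfolding matrix_matrix_mult_def C_def using exhaust_2[of t]
    by (simp only: vec_lambda_beta sum_blk_row[OF that]) auto
  have colt: "(A' ** C) $ i $ j = A' $ i $ j * 2" if "num j > 2 * q" for i j
    unfolding matrix_matrix_mult_def C_def by (simp only: vec_lambda_beta sum_blk_col_tail[OF that])
  have rowt: "(C ** A') $ i $ j = 2 * A' $ i $ j" if "num i > 2 * q" for i j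
    unfolding matrix_matrix_mult_def C_def by (simp only: vec_lambda_beta sum_blk_row_tail[OF that])
  have skew_nth: "A' $ j $ i = - A' $ i $ j" for i j
  proof -
    have "transpose A' $ i $ j = - A' $ i $ j" by (simp only: skew' vector_uminus_component)
    then show ?thesis by (simp only: transpose_def vec_lambda_beta)
  qed
  \<comment> \<open>As q = n div 2, at most one index lies outside the blocks, and only for odd
    n.\<close>
  have tail: "odd CARD('n) \<and> num i = CARD('n)" if "num i > 2 * q" for i
  proof -
    have "num i \<le> CARD('n)" using bij_betwE[OF bij_num] by simp
    then show ?thesis using that q by presburger
  qed
  have off: "A' $ pos num h s $ pos num k t = 0" if hk: "h \<in> {1..q}" "k \<in> {1..q}" "h \<noteq> k" for h k s t
  proof -
    have "\<theta> h \<noteq> \<theta> k" using inj_onD[OF inj_theta _ hk(1,2)] hk(3) by blast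
    then have "cos (\<theta> h) \<noteq> cos (\<theta> k)" using cos_inj_pi[of "\<theta> h" "\<theta> k"] theta[OF hk(1)] theta[OF hk(2)] by blast
    moreover have "A' $ pos num h s $ pos num k t * (2 * cos (\<theta> k)) = (2 * cos (\<theta> h)) * A' $ pos num h s $ pos num k t"
      using col[OF hk(2)] row[OF hk(1)] comm by metis
    ultimately show ?thesis by auto
  qed
  \<comment> \<open>The tail of C carries 2 = 2 cos 0, a value that no block has when n is
    odd.\<close>
  have off_tail: "A' $ pos num h s $ j = 0" if h: "h \<in> {1..q}" and j: "num j > 2 * q" for h s j
  proof -
    have "\<theta> h \<noteq> 0" using theta_odd[OF _ h] tail[OF j] by blast
    then have "cos (\<theta> h) \<noteq> cos 0" using cos_inj_pi[of "\<theta> h" 0] theta[OF h] by auto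
    moreover have "A' $ pos num h s $ j * 2 = (2 * cos (\<theta> h)) * A' $ pos num h s $ j"
      using colt[OF j] row[OF h] comm by metis
    ultimately show ?thesis by auto
  qed
  \<comment> \<open>The entry of x E0 in row 1 and column 2 is x itself; skewness determines the
    rest of the block.\<close>
  define x where "x h = A' $ pos num h 1 $ pos num h 2" for h
  have "A' = blk num q (\<lambda>h. cplx (\<i> * of_real (x h))) (\<lambda>_. 0)"
  proof (rule blk_eqI)
    fix h k s t assume hk: "h \<in> {1..q}" "k \<in> {1..q}"
    have diag: "A' $ i $ i = 0" for i using skew_nth[of i i] by simp
    show "A' $ pos num h s $ pos num k t = (if h = k then cplx (\<i> * of_real (x h)) $ s $ t else 0)"
      using off[OF hk] exhaust_2[of s] exhaust_2[of t] diag
        skew_nth[of "pos num h 2" "pos num h 1"] by (auto simp: x_def)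
  next
    fix i j assume i: "num i > 2 * q"
    show "A' $ i $ j = (if i = j then 0 else 0)"
    proof (cases j rule: pos_cases)
      case 1
      then show ?thesis using off_tail[OF _ i] skew_nth[of i j] by simp
    next
      case 2
      then have "i = j" using tail i inj_num by metis
      then show ?thesis using skew_nth[of i i] by simp
    qed
  next
    fix i j assume j: "num j > 2 * q"
    show "A' $ i $ j = (if i = j then 0 else 0)"
    proof (cases i rule: pos_cases)
      case 1
      then show ?thesis using off_tail[OF _ j] by simp
    next
      case 2
      then have "i = j" using tail j inj_num by metis
      then show ?thesis using skew_nth[of i i] by simp
    qed
  qed
  then have "A = L x"
    unfolding L_def using orthogonal_conj_cancel(2)[OF K, of A] by (simp add: A'_def)
  then show ?thesis by blast
qed

section \<open>Logarithms and principal logarithms in coordinates\<close>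

lemma skew_logs_eq: "skew_logs R = {L (\<lambda>h. \<theta> h + 2 * pi * of_int (r h)) | r :: nat \<Rightarrow> int. True}"
proof (intro set_eqI iffI)
  fix A assume A: "A \<in> skew_logs R"
  then obtain x where x: "A = L x" using skew_log_eq_L by blast
  then have "\<forall>h\<in>{1..q}. \<exists>n::int. x h = \<theta> h + 2 * pi * n"
    using A matexp_L_eq_R by (simp add: skew_logs_def cis_eq_iff)
  then obtain r :: "nat \<Rightarrow> int" where "\<forall>h\<in>{1..q}. x h = \<theta> h + 2 * pi * r h"
    by metis
  then have "A = L (\<lambda>h. \<theta> h + 2 * pi * of_int (r h))"
    unfolding x by (intro L_cong) blast
  then show "A \<in> {L (\<lambda>h. \<theta> h + 2 * pi * of_int (r h)) | r :: nat \<Rightarrow> int. True}" by blast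
next
  fix A assume "A \<in> {L (\<lambda>h. \<theta> h + 2 * pi * of_int (r h)) | r :: nat \<Rightarrow> int. True}"
  then show "A \<in> skew_logs R"
    by (auto simp: skew_logs_def L_skew matexp_L_eq_R cis_eq_iff)
qed

lemma principal_L_iff:
  "(\<forall>c. is_eigenvalue (complexify (L x)) c \<longrightarrow> cmod c \<in> {0..pi}) \<longleftrightarrow> (\<forall>h\<in>{1..q}. \<bar>x h\<bar> \<le> pi)"
  unfolding L_def is_eigenvalue_blk[OF K] by (auto simp: norm_mult)

lemma Aplog_eq: "Aplog R = {L (\<lambda>h. \<theta> h + 2 * pi * of_int (r h)) | r :: nat \<Rightarrow> int.
    \<forall>h\<in>{1..q}. \<bar>\<theta> h + 2 * pi * of_int (r h)\<bar> \<le> pi}"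
proof -
  have "Aplog R = {L (\<lambda>h. \<theta> h + 2 * pi * of_int (r h)) | r :: nat \<Rightarrow> int.
      \<forall>c. is_eigenvalue (complexify (L (\<lambda>h. \<theta> h + 2 * pi * of_int (r h)))) c \<longrightarrow> cmod c \<in> {0..pi}}"
    unfolding Aplog_def skew_logs_eq by blast
  then show ?thesis by (simp only: principal_L_iff)
qed

lemma L_theta_Aplog: "L \<theta> \<in> Aplog R"
proof -
  have "\<forall>h\<in>{1..q}. \<bar>\<theta> h\<bar> \<le> pi"
  proof
    fix h assume "h \<in> {1..q}"
    from theta[OF this] show "\<bar>\<theta> h\<bar> \<le> pi" by simp
  qed
  then show ?thesis unfolding Aplog_eq by (intro CollectI exI[of _ "\<lambda>_. 0"]) simp
qed

text \<open>The interval [-pi, pi] has length 2 pi, so two of its points that differ by a nonzero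
  multiple of 2 pi are its ends. This is the source of the second principal logarithm.\<close>

lemma principal_shift:
  fixes t :: real and r :: int
  assumes "0 \<le> t" "t \<le> pi" "\<bar>t + 2 * pi * r\<bar> \<le> pi"
  shows "r = 0 \<or> r = - 1 \<and> t = pi"
proof -
  have "pi * (2 * r) \<le> pi * 1" "pi * (2 * r) \<ge> pi * (- 2)" using assms by linarith+
  then have "2 * real_of_int r \<le> 1" "2 * real_of_int r \<ge> - 2"
    using pi_gt_zero by (simp_all only: mult_le_cancel_left_pos)
  then have "r = 0 \<or> r = - 1" by linarith
  then show ?thesis using assms by auto
qed

lemma is_eigenvalue_minus_1: "is_eigenvalue (complexify R) (- 1) \<longleftrightarrow> (\<exists>h\<in>{1..q}. \<theta> h = pi)"
proof -
  have "- 1 = cis (\<theta> h) \<longleftrightarrow> \<theta> h = pi" "- 1 = cnj (cis (\<theta> h)) \<longleftrightarrow> \<theta> h = pi" if "h \<in> {1..q}" for h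
    using theta[OF that] cos_inj_pi[of "\<theta> h" pi] by (auto simp: complex_eq_iff)
  then show ?thesis
    unfolding R_eq is_eigenvalue_blk[OF K] by auto
qed

lemma Aplog_no_pi:
  assumes "\<not> (\<exists>h\<in>{1..q}. \<theta> h = pi)"
  shows "Aplog R = {L \<theta>}"
proof -
  have "L (\<lambda>h. \<theta> h + 2 * pi * of_int (r h)) = L \<theta>"
    if "\<forall>h\<in>{1..q}. \<bar>\<theta> h + 2 * pi * of_int (r h)\<bar> \<le> pi" for r :: "nat \<Rightarrow> int"
  proof (rule L_cong)
    fix h assume "h \<in> {1..q}"
    then show "\<theta> h + 2 * pi * of_int (r h) = \<theta> h"
      using principal_shift[of "\<theta> h" "r h"] theta[of h] that assms by auto
  qed
  then have "Aplog R \<subseteq> {L \<theta>}" unfolding Aplog_eq by blast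
  then show ?thesis using L_theta_Aplog by blast
qed

text \<open>Injectivity of \<theta> confines the angle pi to the first plane, so only its coordinate
  can be shifted; r 1 = - 1 turns pi into - pi.\<close>

lemma Aplog_pi:
  assumes "1 \<in> {1..q}" "\<theta> 1 = pi"
  shows "Aplog R = {L \<theta>, L (\<theta>(1 := - pi))}"
proof -
  have "L (\<lambda>h. \<theta> h + 2 * pi * of_int (r h)) \<in> {L \<theta>, L (\<theta>(1 := - pi))}"
    if r: "\<forall>h\<in>{1..q}. \<bar>\<theta> h + 2 * pi * of_int (r h)\<bar> \<le> pi" for r :: "nat \<Rightarrow> int"
  proof -
    have other: "r h = 0" if "h \<in> {1..q}" "h \<noteq> 1" for h
    proof -
      have "\<theta> h \<noteq> pi" using inj_theta that assms by (metis inj_onD)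
      then show ?thesis using principal_shift[of "\<theta> h" "r h"] theta[of h] r that by auto
    qed
    have "r 1 = 0 \<or> r 1 = - 1"
      using principal_shift[of "\<theta> 1" "r 1"] theta[of 1] r assms by blast
    then show ?thesis
    proof
      assume "r 1 = 0"
      then have "L (\<lambda>h. \<theta> h + 2 * pi * of_int (r h)) = L \<theta>"
        using other by (intro L_cong) (metis add.right_neutral mult_zero_right of_int_0)
      then show ?thesis by simp
    next
      assume "r 1 = - 1"
      then have "L (\<lambda>h. \<theta> h + 2 * pi * of_int (r h)) = L (\<theta>(1 := - pi))"
        using other assms by (intro L_cong) auto
      then show ?thesis by simp
    qed
  qed
  then have "Aplog R \<subseteq> {L \<theta>, L (\<theta>(1 := - pi))}" unfolding Aplog_eq by blast
  moreover have "L (\<theta>(1 := - pi)) \<in> Aplog R"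
  proof -
    have "L (\<theta>(1 := - pi)) = L (\<lambda>h. \<theta> h + 2 * pi * of_int (if h = 1 then - 1 else 0))"
      using assms by (intro L_cong) auto
    moreover have "\<forall>h\<in>{1..q}. \<bar>\<theta> h + 2 * pi * of_int (if h = 1 then - 1 else 0)\<bar> \<le> pi"
    proof
      fix h assume "h \<in> {1..q}"
      from theta[OF this] show "\<bar>\<theta> h + 2 * pi * of_int (if h = 1 then - 1 else 0)\<bar> \<le> pi"
        using assms by auto
    qed
    ultimately show ?thesis
      unfolding Aplog_eq by (intro CollectI exI[of _ "\<lambda>h. if h = 1 then - 1 else 0"] conjI)
  qed
  ultimately show ?thesis using L_theta_Aplog by blast
qed

text \<open>Different logarithms differ by at least 2 pi in some coordinate, and the coordinates are
  linear with a common bound C, so the distance is at least 2 pi / C.\<close>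

lemma discrete_skew_logs: "discrete (skew_logs R)"
proof -
  obtain C where C: "C > 0" "\<And>X. norm (transpose K ** X ** K) \<le> norm X * C"
    using bounded_linear.pos_bounded[OF bounded_linear_conj[of "transpose K" K]] by blast
  have coord_le: "\<bar>coord h X\<bar> \<le> norm X * C" for h X
    unfolding coord_def
    by (rule order_trans[OF component_le_norm_cart order_trans[OF Finite_Cartesian_Product.norm_nth_le C(2)]])
  have "A = B" if AB: "A \<in> skew_logs R" "B \<in> skew_logs R" "dist A B < 2 * pi / C" for A B
  proof -
    obtain r s :: "nat \<Rightarrow> int" where
      A: "A = L (\<lambda>h. \<theta> h + 2 * pi * of_int (r h))" and B: "B = L (\<lambda>h. \<theta> h + 2 * pi * of_int (s h))"
      using AB by (auto simp: skew_logs_eq)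
    have "r h = s h" if h: "h \<in> {1..q}" for h
    proof -
      have "coord h (A - B) = 2 * pi * of_int (r h - s h)"
        unfolding A B L_diff by (simp only: coord_L[OF h]) (simp add: algebra_simps)
      then have "2 * pi * \<bar>of_int (r h - s h)\<bar> \<le> norm (A - B) * C"
        using coord_le[of h "A - B"] by (simp add: abs_mult)
      also have "\<dots> < 2 * pi"
        using AB(3) C(1) by (simp add: dist_norm field_simps)
      finally have "\<bar>of_int (r h - s h) :: real\<bar> < 1" by simp
      then show ?thesis by linarith
    qed
    then show ?thesis unfolding A B by (intro L_cong) simp
  qed
  moreover have "2 * pi / C > 0" using C(1) by simp
  ultimately show ?thesis
    by (intro uniform_discrete_imp_discrete) (auto simp: uniform_discrete_def)
qed

text \<open>The base point is \<open>L \<theta>\<close> and the generators are the matrices 2 pi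
  B_h. That they are distinct and independent follows by reading off coordinates.\<close>

lemma discrete_lattice_skew_logs: "discrete_lattice_in skew_matrices q (skew_logs R)"
proof -
  define g where "g h = (2 * pi) *\<^sub>R Bmat num K h" for h
  define G where "G = g ` {1..q}"
  have g_sum: "(\<Sum>h=1..q. x h *\<^sub>R g h) = L (\<lambda>h. 2 * pi * x h)" for x
    unfolding L_eq_sum g_def by (simp add: mult.commute)
  have inj: "inj_on g {1..q}"
  proof (rule inj_onI)
    fix h k assume hk: "h \<in> {1..q}" "k \<in> {1..q}" "g h = g k"
    then have "Bmat num K h = Bmat num K k" by (simp add: g_def)
    then have "coord h (Bmat num K h) = coord h (Bmat num K k)" by simp
    then show "h = k" using coord_L[OF hk(1)] by (simp add: Bmat_eq_L split: if_splits)
  qed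
  have sum_G: "(\<Sum>y\<in>G. F y) = (\<Sum>h=1..q. F (g h))" for F :: "real^'n^'n \<Rightarrow> real^'n^'n"
    unfolding G_def by (simp only: sum.reindex[OF inj] comp_def)
  have G: "G \<subseteq> skew_matrices"
    unfolding G_def g_def Bmat_eq_L L_scale[symmetric] using L_skew by blast
  have "independent G"
  proof (rule independent_if_scalars_zero)
    show "finite G" by (simp add: G_def)
    fix f x assume "(\<Sum>y\<in>G. f y *\<^sub>R y) = 0" and "x \<in> G"
    then have "L (\<lambda>h. 2 * pi * f (g h)) = L (\<lambda>_. 0)"
      unfolding sum_G g_sum L_0 by simp
    then have "\<forall>h\<in>{1..q}. 2 * pi * f (g h) = 0" unfolding L_eq_iff .
    then show "f x = 0" using \<open>x \<in> G\<close> by (auto simp: G_def)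
  qed
  moreover have "skew_logs R = {L \<theta> + (\<Sum>y\<in>G. real_of_int (m y) *\<^sub>R y) | m. True}"
  proof -
    have eq: "L \<theta> + (\<Sum>y\<in>G. real_of_int (m y) *\<^sub>R y) = L (\<lambda>h. \<theta> h + 2 * pi * of_int (m (g h)))" for m
      unfolding sum_G g_sum L_add by simp
    \<comment> \<open>Lattice coefficients are indexed by generators, shifts of angles by planes;
      \<open>inv_into\<close> translates the latter into the former.\<close>
    have r_eq: "L (\<lambda>h. \<theta> h + 2 * pi * of_int (r h)) =
        L (\<lambda>h. \<theta> h + 2 * pi * of_int ((r \<circ> inv_into {1..q} g) (g h)))" for r :: "nat \<Rightarrow> int"
      by (rule L_cong) (simp only: inv_into_f_f[OF inj] comp_apply)
    show ?thesis
      unfolding skew_logs_eq eq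
    proof (intro set_eqI iffI; elim CollectE exE conjE)
      fix A r assume "A = L (\<lambda>h. \<theta> h + 2 * pi * real_of_int (r h))"
      then show "A \<in> {L (\<lambda>h. \<theta> h + 2 * pi * real_of_int (m (g h))) | m. True}"
        unfolding r_eq[of r] by (intro CollectI exI conjI TrueI)
    next
      fix A m assume "A = L (\<lambda>h. \<theta> h + 2 * pi * real_of_int (m (g h)))"
      then show "A \<in> {L (\<lambda>h. \<theta> h + 2 * pi * real_of_int (r h)) | r. True}"
        by (intro CollectI exI[of _ "\<lambda>h. m (g h)"] conjI TrueI)
    qed
  qed
  moreover have "skew_logs R \<subseteq> skew_matrices" by (auto simp: skew_logs_def)
  moreover have "card G = q" unfolding G_def card_image[OF inj] by simp
  moreover have "finite G" by (simp add: G_def)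
  ultimately show ?thesis
    unfolding discrete_lattice_in_def using G L_skew discrete_skew_logs by blast
qed

end

section \<open>Existence of the angles and of the basis\<close>

lemma (in numbering) card_num: "S \<subseteq> {1..CARD('n)} \<Longrightarrow> card {i. num i \<in> S} = card S"
  using card_vimage_inj[of num S] bij_num by (simp add: bij_betw_def vimage_def)

text \<open>Two final diagonal entries 1 are the same as an identity block. In this way an
  eigenvalue 1 of multiplicity 2 becomes a plane of angle 0.\<close>

lemma blk_Suc:
  fixes M :: "nat \<Rightarrow> 'a::zero_neq_one^2^2"
  assumes "numbering num (Suc p)" "M (Suc p) = mat 1"
  shows "blk num p M (\<lambda>_. 1) = blk num (Suc p) M (\<lambda>_. 1)"
proof -
  interpret numbering num "Suc p" by fact
  show ?thesis
  proof (rule blk_eqI)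
    fix h k s t assume hk: "h \<in> {1..Suc p}" "k \<in> {1..Suc p}"
    have le: "num (pos num m u) \<le> 2 * p \<longleftrightarrow> m \<noteq> Suc p" if "m \<in> {1..Suc p}" for m u
      using that by (auto simp: num_pos)
    have nth: "blk num p M (\<lambda>_. 1) $ pos num h s $ pos num k t =
        (if h \<noteq> Suc p \<and> k \<noteq> Suc p
         then if h = k then M h $ (if s = 1 then 1 else 2) $ (if t = 1 then 1 else 2) else 0
         else if h = k \<and> s = t then 1 else 0)"
      unfolding blk_def vec_lambda_beta num_pos_facts(2,3)[OF hk(1)] num_pos_facts(2,3)[OF hk(2)]
        le[OF hk(1)] le[OF hk(2)] pos_eq_iff[OF hk] ..
    show "blk num p M (\<lambda>_. 1) $ pos num h s $ pos num k t = (if h = k then M h $ s $ t else 0)"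
      unfolding nth using exhaust_2[of s] exhaust_2[of t] assms(2) by (auto simp: mat_def)
  qed (simp_all add: blk_def)
qed

text \<open>Only for n = 2 p + 2 does q exceed p, and then the additional angle is 0 by convention.
  The other angles are positive, so all of them stay distinct.\<close>

lemma log_data_imp_rotation_form:
  fixes R :: "real^'n^'n"
  assumes "log_data R num p \<theta> K"
  shows "rotation_form num (CARD('n) div 2) R K \<theta>"
proof -
  define q where "q = CARD('n) div 2"
  note ld = assms[unfolded log_data_def]
  have "numbering num q"
    using ld by unfold_locales (auto simp: q_def)
  have cases: "q = p \<or> q = Suc p \<and> CARD('n) = 2 * p + 2 \<and> \<theta> q = 0"
  proof -
    consider "CARD('n) = 2 * p" | "CARD('n) = 2 * p + 1" | "CARD('n) = 2 * p + 2"
      using ld by linarith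
    then show ?thesis using ld by cases (simp_all add: q_def)
  qed
  have "blk num p (\<lambda>h. cplx (cis (\<theta> h))) (\<lambda>_. 1) = blk num q (\<lambda>h. cplx (cis (\<theta> h))) (\<lambda>_. 1 :: real)"
    using cases
  proof
    assume q: "q = Suc p \<and> CARD('n) = 2 * p + 2 \<and> \<theta> q = 0"
    then have "cplx (cis (\<theta> (Suc p))) = mat 1" by (auto simp: cplx_1)
    then show ?thesis
      using blk_Suc[of num p "\<lambda>h. cplx (cis (\<theta> h))"] \<open>numbering num q\<close> q by auto
  qed simp
  then have R: "R = K ** blk num q (\<lambda>h. cplx (cis (\<theta> h))) (\<lambda>_. 1) ** transpose K"
    using ld by (simp add: block_diag_eq_blk matexp_E0)
  have theta: "\<theta> h \<in> {0<..pi}" if "h \<in> {1..p}" for h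
    using ld that by blast
  have q_cases: "h \<in> {1..p} \<or> \<theta> h = 0 \<and> h = Suc p \<and> even CARD('n)" if "h \<in> {1..q}" for h
    using cases that by (auto simp: le_Suc_eq)
  have inj: "inj_on \<theta> {1..q}"
  proof (rule inj_onI)
    fix h k assume hk: "h \<in> {1..q}" "k \<in> {1..q}" "\<theta> h = \<theta> k"
    have "inj_on \<theta> {1..p}" using ld by blast
    then show "h = k"
      using q_cases[OF hk(1)] q_cases[OF hk(2)] theta[of h] theta[of k] hk(3)
      by (metis greaterThanAtMost_iff inj_onD less_irrefl)
  qed
  have K: "orthogonal_matrix K" using ld by blast
  have range: "0 \<le> \<theta> h \<and> \<theta> h \<le> pi" "odd CARD('n) \<Longrightarrow> \<theta> h \<noteq> 0" if "h \<in> {1..q}" for h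
    using q_cases[OF that] theta[of h] pi_ge_zero by auto
  show ?thesis
    using \<open>numbering num q\<close> K R range inj
    unfolding q_def[symmetric] rotation_form_def rotation_form_axioms_def
    by (auto simp: q_def)
qed

text \<open>Eigenvectors for -1 are expected to be joined already into a plane of angle pi, hence
  the empty list and the bound \<theta> \<le> pi; \<open>m1\<close> asks that this plane come
  first.\<close>

lemma log_data_of_normal_system:
  fixes R :: "real^'n^'n"
  assumes sys: "normal_system R Pl [] Ps" and len: "length (plane_vecs Pl @ Ps) = CARD('n)"
    and angles: "\<forall>(\<theta>, u, v)\<in>set Pl. 0 < \<theta> \<and> \<theta> \<le> pi" "distinct (map fst Pl)" and Ps: "length Ps \<le> 2"
    and m1: "is_eigenvalue (complexify R) (-1) \<Longrightarrow> Pl \<noteq> [] \<and> fst (hd Pl) = pi"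
  shows "\<exists>num p \<theta> K. log_data R num p \<theta> K"
proof -
  obtain num :: "'n \<Rightarrow> nat" where bij: "bij_betw num UNIV {1..CARD('n)}"
    using finite_same_card_bij[of "UNIV :: 'n set" "{1..CARD('n)}"] by auto
  define p where "p = length Pl"
  \<comment> \<open>Block h has list position h - 1; the value 0 beyond p supplies the angle
    \<theta> (p + 1) = 0 required when n = 2 p + 2.\<close>
  define \<theta> where "\<theta> h = (if h \<le> p then fst (Pl ! (h - 1)) else 0)" for h
  interpret numbering num p
    using bij len by unfold_locales (simp_all add: p_def)
  obtain K where K: "orthogonal_matrix K" and R: "R = K ** blk num p (\<lambda>h. cplx (cis (fst (Pl ! (h - 1)))))
      (\<lambda>i. if num i \<le> 2 * p + length ([] :: (real^'n) list) then - 1 else 1) ** transpose K"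
    using normal_system_matrix[OF sys _ bij] len unfolding p_def by auto
  have "blk num p (\<lambda>h. cplx (cis (fst (Pl ! (h - 1)))))
      (\<lambda>i. if num i \<le> 2 * p + length ([] :: (real^'n) list) then - 1 else 1) =
      blk num p (\<lambda>h. cplx (cis (\<theta> h))) (\<lambda>_. 1)"
    unfolding blk_eq_iff by (simp add: \<theta>_def)
  then have R': "R = K ** block_diag num p (\<lambda>h. matexp (\<theta> h *\<^sub>R E0)) 1 ** transpose K"
    using R by (simp add: block_diag_eq_blk matexp_E0)
  have nth: "fst (Pl ! m) \<in> {0<..pi}" if "m < length Pl" for m
  proof -
    obtain t u v where t: "Pl ! m = (t, u, v)" by (cases "Pl ! m")
    then have "(t, u, v) \<in> set Pl" using that by (metis nth_mem)
    then show ?thesis using angles(1) t by auto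
  qed
  have "\<forall>h\<in>{1..p}. \<theta> h \<in> {0<..pi}"
    using nth by (auto simp: \<theta>_def p_def)
  moreover have "inj_on \<theta> {1..p}"
  proof (rule inj_onI)
    fix h k assume hk: "h \<in> {1..p}" "k \<in> {1..p}" "\<theta> h = \<theta> k"
    then have "map fst Pl ! (h - 1) = map fst Pl ! (k - 1)"
      by (auto simp: \<theta>_def p_def nth_map)
    then have "h - 1 = k - 1"
      using angles(2) hk by (subst (asm) nth_eq_iff_index_eq) (auto simp: p_def)
    then show "h = k" using hk by auto
  qed
  moreover have "is_eigenvalue (complexify R) (-1) \<Longrightarrow> 1 \<le> p \<and> \<theta> 1 = pi"
    using m1 by (cases Pl) (auto simp: p_def \<theta>_def)
  ultimately have "log_data R num p \<theta> K"
    unfolding log_data_def using bij K R' len Ps le_card by (auto simp: p_def \<theta>_def)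
  then show ?thesis by blast
qed

text \<open>Counting fibres of \<open>eigs\<close> turns the multiplicities into facts about the
  lists: \<open>Ms\<close> has 0 or 2 elements, \<open>Ps\<close> has at most 2, and no angle is
  repeated.\<close>

lemma log_data_exists:
  fixes R :: "real^'n^'n"
  assumes R: "orthogonal_matrix R"
    and nonreal: "\<And>c. is_eigenvalue (complexify R) c \<Longrightarrow> c \<notin> \<real> \<Longrightarrow> eig_mult (complexify R) c = 1"
    and minus: "\<not> is_eigenvalue (complexify R) (-1) \<or> eig_mult (complexify R) (-1) = 2"
    and plus: "\<not> is_eigenvalue (complexify R) 1 \<or> eig_mult (complexify R) 1 \<le> 2"
  shows "\<exists>num p \<theta> K. log_data R num p \<theta> K"
proof -
  obtain Pl Ms Ps where sys: "normal_system R Pl Ms Ps"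
    and angles: "\<forall>(\<theta>, u, v)\<in>set Pl. 0 < \<theta> \<and> \<theta> < pi"
    and len: "length (plane_vecs Pl @ Ms @ Ps) = CARD('n)"
    using normal_system_exists[OF R] by blast
  obtain num :: "'n \<Rightarrow> nat" where bij: "bij_betw num UNIV {1..CARD('n)}"
    using finite_same_card_bij[of "UNIV :: 'n set" "{1..CARD('n)}"] by auto
  define p where "p = length Pl"
  define d where "d i = (if num i \<le> 2 * p + length Ms then - 1 else 1 :: real)" for i
  define z where "z h = cis (fst (Pl ! (h - 1)))" for h
  interpret numbering num p
    using bij len by unfold_locales (simp_all add: p_def)
  obtain K where K: "orthogonal_matrix K"
    and R_eq: "R = K ** blk num p (\<lambda>h. cplx (z h)) d ** transpose K"
    using normal_system_matrix[OF sys len bij] unfolding p_def d_def z_def by blast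
  have mult: "eig_mult (complexify R) c = card {i. eigs z d i = c}" for c
    unfolding R_eq by (rule eig_mult_blk[OF K])
  have eig: "is_eigenvalue (complexify R) c \<longleftrightarrow> card {i. eigs z d i = c} \<noteq> 0" for c
  proof -
    obtain P P' where "diagonalization (complexify R) P P' (eigs z d)"
      using diagonalization_blk[OF K, of z d] unfolding R_eq by blast
    then show ?thesis by (simp add: diagonalization.is_eigenvalue_iff card_eq_0_iff)
  qed
  \<comment> \<open>The blocks have nonreal eigenvalues only, so the values -1 and 1 come from the
    tail alone.\<close>
  have Im_z: "Im (z h) > 0" if "h \<in> {1..p}" for h
  proof -
    obtain t u v where t: "Pl ! (h - 1) = (t, u, v)" by (cases "Pl ! (h - 1)")
    have "h - 1 < length Pl" using that by (auto simp: p_def)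
    then have "(t, u, v) \<in> set Pl" using t by (metis nth_mem)
    then have "0 < t \<and> t < pi" using angles by auto
    then show ?thesis using t by (simp add: z_def sin_gt_zero)
  qed
  have num_le: "num i \<le> CARD('n)" for i using bij_betwE[OF bij] by simp
  have eigs_real: "eigs z d i = of_real e \<longleftrightarrow> num i > 2 * p \<and> d i = e" for i e
  proof (cases i rule: pos_cases)
    case (1 h s)
    then have "Im (eigs z d i) \<noteq> 0" using Im_z[OF 1(1)] by (simp add: eigs_pos)
    then show ?thesis using 1 num_pos_facts(1)[OF 1(1), of s] by auto
  qed (simp add: eigs_tail)
  have "{i. eigs z d i = of_real (- 1)} = {i. num i \<in> {2 * p + 1..2 * p + length Ms}}"
    unfolding eigs_real by (auto simp: d_def)
  moreover have "{2 * p + 1..2 * p + length Ms} \<subseteq> {1..CARD('n)}"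
    using len by (auto simp: p_def)
  ultimately have card_Ms: "card {i. eigs z d i = - 1} = length Ms"
    by (simp add: card_num del: atLeastAtMost_iff)
  have "{i. eigs z d i = of_real 1} = {i. num i \<in> {2 * p + length Ms + 1..CARD('n)}}"
    unfolding eigs_real using num_le by (auto simp: d_def)
  moreover have "{2 * p + length Ms + 1..CARD('n)} \<subseteq> {1..CARD('n)}"
    by auto
  moreover have "CARD('n) = 2 * p + length Ms + length Ps"
    using len by (simp add: p_def)
  ultimately have card_Ps: "card {i. eigs z d i = 1} = length Ps"
    by (simp add: card_num del: atLeastAtMost_iff)
  have "distinct (map fst Pl)"
    unfolding distinct_conv_nth
  proof (intro allI impI)
    fix m m' assume m: "m < length (map fst Pl)" "m' < length (map fst Pl)" "m \<noteq> m'"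
    define h where "h = Suc m"
    define k where "k = Suc m'"
    have hk: "h \<in> {1..p}" "k \<in> {1..p}" "h \<noteq> k" using m by (auto simp: h_def k_def p_def)
    show "map fst Pl ! m \<noteq> map fst Pl ! m'"
    proof
      assume "map fst Pl ! m = map fst Pl ! m'"
      then have "z h = z k" using m by (simp add: z_def h_def k_def)
      \<comment> \<open>Equal angles put two indices into the fibre of one nonreal eigenvalue,
        against its multiplicity 1.\<close>
      then have mem: "pos num h 1 \<in> {i. eigs z d i = z h}" "pos num k 1 \<in> {i. eigs z d i = z h}"
        using eigs_pos[OF hk(1)] eigs_pos[OF hk(2)] by simp_all
      then have "is_eigenvalue (complexify R) (z h)"
        unfolding eig by (auto simp: card_eq_0_iff)
      moreover have "z h \<notin> \<real>" using Im_z[OF hk(1)] by (auto simp: complex_is_Real_iff)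
      ultimately have "card {i. eigs z d i = z h} = 1" using nonreal mult by metis
      then have "pos num h 1 = pos num k 1" using mem by (metis card_1_singletonE singletonD)
      then show False using pos_eq_iff[OF hk(1,2)] hk(3) by blast
    qed
  qed
  have Ps: "length Ps \<le> 2" using plus mult[of 1] eig[of 1] card_Ps by auto
  have Ms: "length Ms = 0 \<or> length Ms = 2" using minus mult[of "- 1"] eig[of "- 1"] card_Ms by auto
  show ?thesis
  proof (cases "Ms = []")
    case True
    then have "\<not> is_eigenvalue (complexify R) (- 1)" using eig[of "- 1"] card_Ms by simp
    moreover have "\<forall>(\<theta>, u, v)\<in>set Pl. 0 < \<theta> \<and> \<theta> \<le> pi" using angles by force
    ultimately show ?thesis
      using log_data_of_normal_system[of R Pl Ps] sys len \<open>distinct (map fst Pl)\<close> Ps True by simp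
  next
    case False
    then have "length Ms = 2" using Ms by simp
    \<comment> \<open>the two eigenvectors for \<open>- 1\<close> span a plane that is rotated by \<open>pi\<close>\<close>
    then obtain a b where Ms: "Ms = [a, b]"
      by (auto simp: numeral_2_eq_2 length_Suc_conv)
    have "orthonormal_list (a # b # plane_vecs Pl @ Ps) \<longleftrightarrow> orthonormal_list (plane_vecs Pl @ Ms @ Ps)"
      by (rule orthonormal_list_cong) (simp add: Ms)
    then have sys': "normal_system R ((pi, a, b) # Pl) [] Ps"
      using sys by (simp add: normal_system_def Ms)
    \<comment> \<open>The new angle is not a repetition, as the others are below pi. Its plane
      stands at the head of the list because \<theta> 1 = pi is prescribed.\<close>
    have "pi \<notin> fst ` set Pl" using angles by force
    then have "distinct (map fst ((pi, a, b) # Pl))" using \<open>distinct (map fst Pl)\<close> by simp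
    moreover have "\<forall>(\<theta>, u, v)\<in>set ((pi, a, b) # Pl). 0 < \<theta> \<and> \<theta> \<le> pi" using angles by force
    ultimately show ?thesis
      using log_data_of_normal_system[OF sys'] len Ps Ms by simp
  qed
qed

section \<open>From coordinates to sums of the matrices \<open>Bmat\<close>\<close>

context rotation_form
begin

lemma L_shift: "L (\<lambda>h. \<theta> h + 2 * pi * of_int (r h)) = L \<theta> + (2 * pi) *\<^sub>R L (\<lambda>h. of_int (r h))"
  by (simp add: L_add L_scale)

lemma skew_log_iff:
  "A \<in> skew_logs R \<longleftrightarrow> (\<exists>r :: nat \<Rightarrow> int.
    A = (\<Sum>h=1..q. (\<theta> h + 2 * pi * real_of_int (r h)) *\<^sub>R Bmat num K h) \<and>
    A = (\<Sum>h=1..q. \<theta> h *\<^sub>R Bmat num K h) + (2 * pi) *\<^sub>R (\<Sum>h=1..q. real_of_int (r h) *\<^sub>R Bmat num K h))"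
  unfolding L_eq_sum[symmetric] L_shift skew_logs_eq by blast

lemma L_upd_1:
  assumes "1 \<in> {1..q}"
  shows "L (\<theta>(1 := c)) = c *\<^sub>R Bmat num K 1 + (\<Sum>h=2..q. \<theta> h *\<^sub>R Bmat num K h)"
  using assms unfolding L_eq_sum
  by (subst sum.atLeast_Suc_atMost) (auto simp: numeral_2_eq_2 intro!: sum.cong)

end

theorem theorem3p8:
  fixes R :: "real^'n^'n"
  assumes "rotation_matrix R"
    and "\<And>c. is_eigenvalue (complexify R) c \<Longrightarrow> c \<notin> \<real> \<Longrightarrow> eig_mult (complexify R) c = 1"
    and "\<not> is_eigenvalue (complexify R) (-1) \<or> eig_mult (complexify R) (-1) = 2"
    and "\<not> is_eigenvalue (complexify R) 1 \<or> eig_mult (complexify R) 1 \<le> 2"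
  shows "(\<forall>num p \<theta> K. log_data R num p \<theta> K \<longrightarrow>
           (let q = CARD('n) div 2;
                Bh = Bmat num K;
                B = (\<Sum>h=1..q. \<theta> h *\<^sub>R Bh h)
            in
              B \<in> Aplog R \<and>
              (is_eigenvalue (complexify R) (-1) \<longleftrightarrow> 1 \<le> p \<and> \<theta> 1 = pi) \<and>
              (\<not> is_eigenvalue (complexify R) (-1) \<longrightarrow> Aplog R = {B}) \<and>
              (is_eigenvalue (complexify R) (-1) \<longrightarrow>
                 B = pi *\<^sub>R Bh 1 + (\<Sum>h=2..q. \<theta> h *\<^sub>R Bh h) \<and>
                 Aplog R = {B, - pi *\<^sub>R Bh 1 + (\<Sum>h=2..q. \<theta> h *\<^sub>R Bh h)}) \<and>
              (\<forall>A\<in>skew_matrices.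
                 A \<in> skew_logs R \<longleftrightarrow>
                 (\<exists>r :: nat \<Rightarrow> int.
                    A = (\<Sum>h=1..q. (\<theta> h + 2 * pi * real_of_int (r h)) *\<^sub>R Bh h) \<and>
                    A = B + (2 * pi) *\<^sub>R (\<Sum>h=1..q. real_of_int (r h) *\<^sub>R Bh h)))))
         \<and> discrete_lattice_in skew_matrices (CARD('n) div 2) (skew_logs R)"
proof (intro conjI allI impI)
  fix num :: "'n \<Rightarrow> nat" and p \<theta> K
  assume ld: "log_data R num p \<theta> K"
  define q where "q = CARD('n) div 2"
  interpret rotation_form num q R K \<theta>
    unfolding q_def by (rule log_data_imp_rotation_form[OF ld])
  \<comment> \<open>This places plane 1 among the q planes as soon as 1 \<le> p.\<close>
  have "p \<le> q" using le_card ld by (auto simp: q_def log_data_def)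
  have iff: "is_eigenvalue (complexify R) (- 1) \<longleftrightarrow> 1 \<le> p \<and> \<theta> 1 = pi"
  proof
    assume "is_eigenvalue (complexify R) (- 1)"
    then show "1 \<le> p \<and> \<theta> 1 = pi" using ld by (simp add: log_data_def)
  next
    assume "1 \<le> p \<and> \<theta> 1 = pi"
    then have "1 \<in> {1..q} \<and> \<theta> 1 = pi" using \<open>p \<le> q\<close> by simp
    then show "is_eigenvalue (complexify R) (- 1)" unfolding is_eigenvalue_minus_1 by blast
  qed
  have pi_case: "L \<theta> = pi *\<^sub>R Bmat num K 1 + (\<Sum>h=2..q. \<theta> h *\<^sub>R Bmat num K h) \<and>
      Aplog R = {L \<theta>, - pi *\<^sub>R Bmat num K 1 + (\<Sum>h=2..q. \<theta> h *\<^sub>R Bmat num K h)}"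
    if "is_eigenvalue (complexify R) (- 1)"
  proof -
    have 1: "1 \<in> {1..q}" "\<theta> 1 = pi" using that iff \<open>p \<le> q\<close> by auto
    \<comment> \<open>Overwriting coordinate 1 by its own value pi splits off the first summand of
      B; overwriting it by - pi gives the other logarithm.\<close>
    show ?thesis
      using L_upd_1[OF 1(1), of pi] L_upd_1[OF 1(1), of "- pi"] Aplog_pi[OF 1] 1(2) by (simp add: fun_upd_idem)
  qed
  have no_pi: "Aplog R = {L \<theta>}" if "\<not> is_eigenvalue (complexify R) (- 1)"
    using Aplog_no_pi that unfolding is_eigenvalue_minus_1 .
  show "let q = CARD('n) div 2;
                Bh = Bmat num K;
                B = (\<Sum>h=1..q. \<theta> h *\<^sub>R Bh h)
            in
              B \<in> Aplog R \<and>
              (is_eigenvalue (complexify R) (-1) \<longleftrightarrow> 1 \<le> p \<and> \<theta> 1 = pi) \<and>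
              (\<not> is_eigenvalue (complexify R) (-1) \<longrightarrow> Aplog R = {B}) \<and>
              (is_eigenvalue (complexify R) (-1) \<longrightarrow>
                 B = pi *\<^sub>R Bh 1 + (\<Sum>h=2..q. \<theta> h *\<^sub>R Bh h) \<and>
                 Aplog R = {B, - pi *\<^sub>R Bh 1 + (\<Sum>h=2..q. \<theta> h *\<^sub>R Bh h)}) \<and>
              (\<forall>A\<in>skew_matrices.
                 A \<in> skew_logs R \<longleftrightarrow>
                 (\<exists>r :: nat \<Rightarrow> int.
                    A = (\<Sum>h=1..q. (\<theta> h + 2 * pi * real_of_int (r h)) *\<^sub>R Bh h) \<and>
                    A = B + (2 * pi) *\<^sub>R (\<Sum>h=1..q. real_of_int (r h) *\<^sub>R Bh h)))"
    unfolding Let_def q_def[symmetric]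
    using L_theta_Aplog iff no_pi pi_case skew_log_iff unfolding L_eq_sum[of \<theta>] by blast
next
  \<comment> \<open>The lattice claim mentions no data, so the existence of some choice has to be
    supplied here.\<close>
  have "orthogonal_matrix R" using assms(1) by (simp add: rotation_matrix_def)
  from log_data_exists[OF this assms(2-4)] obtain num p \<theta> K where "log_data R num p \<theta> K"
    by blast
  then interpret rotation_form num "CARD('n) div 2" R K \<theta>
    by (rule log_data_imp_rotation_form)
  show "discrete_lattice_in skew_matrices (CARD('n) div 2) (skew_logs R)"
    by (rule discrete_lattice_skew_logs)
qed

end
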